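(* Let $\{(\mathbf{D}_{(i)}^\nu,\mathbf{X}_i^\nu)_{i=1}^I\}_{\nu\ge 0}$ be the (infinite) sequence generated by the D$^2$L algorithm described in the context, applied to the problem $$\min_{\mathbf{D}\in\mathcal{D},\ \{\mathbf{X}_i\}_{i=1}^I}\ \sum_{i=1}^I\Big[\tfrac12\|\mathbf{S}_i-\mathbf{D}\mathbf{X}_i\|_F^2+\lambda\|\mathbf{X}_i\|_{1,1}+\mu\|\mathbf{X}_i\|_F^2\Big],\qquad(\mathrm{P2})$$ and let $\overline{\mathbf{D}}^\nu\triangleq\frac1I\sum_{i=1}^I\mathbf{D}_{(i)}^\nu$ and $\mathbf{X}^\nu\triangleq[\mathbf{X}_1^\nu,\ldots,\mathbf{X}_I^\nu]$. Suppose that Assumptions A, B and C (stated in the context) are satisfied. Then: (i) the sequence $\{(\overline{\mathbf{D}}^\nu,\mathbf{X}^\nu)\}_\nu$ is bounded, and any of its limit points is a stationary solution of (P2), and thus of the equivalent problem $$\min_{\mathbf{D}\in\mathcal{D},\ \mathbf{X}\in\mathbb{R}^{K\times N}}\ \tfrac12\|\mathbf{S}-\mathbf{D}\mathbf{X}\|_F^2+\lambda\|\mathbf{X}\|_{1,1}+\mu\|\mathbf{X}\|_F^2;\qquad(\mathrm{P1})$$ (ii) all the sequences $\{\mathbf{D}_{(i)}^\nu\}_\nu$ asymptotically reach consensus, i.e., $\lim_{\nu\to\infty}\|\mathbf{D}_{(i)}^\nu-\overline{\mathbf{D}}^\nu\|=0$ for all $i=1,\ldots,I$.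
   Context: **Problem data.** $I,M,K,n_1,\ldots,n_I$ are positive integers and $N=\sum_{i=1}^I n_i$. The data matrix $\mathbf{S}=[\mathbf{S}_1,\ldots,\mathbf{S}_I]\in\mathbb{R}^{M\times N}$ has blocks $\mathbf{S}_i\in\mathbb{R}^{M\times n_i}$; the variables are $\mathbf{D}\in\mathbb{R}^{M\times K}$ and $\mathbf{X}=[\mathbf{X}_1,\ldots,\mathbf{X}_I]\in\mathbb{R}^{K\times N}$ with $\mathbf{X}_i\in\mathbb{R}^{K\times n_i}$. The constants satisfy $\lambda,\mu,\alpha>0$. The feasible set for $\mathbf{D}$ is $\mathcal{D}=\{\mathbf{D}\in\mathbb{R}^{M\times K}:\|\mathbf{D}\mathbf{e}_k\|_2\le\alpha,\ k=1,\ldots,K\}$, where $\mathbf{e}_k$ is the $k$-th canonical vector. Notation: $\|\mathbf{X}\|_{1,1}=\sum_{i,j}|X_{ij}|$, $\|\cdot\|_F$ is the Frobenius norm, $\langle\mathbf{A},\mathbf{B}\rangle=\mathrm{tr}(\mathbf{A}^T\mathbf{B})$, and $f_i(\mathbf{D},\mathbf{X}_i)=\frac12\|\mathbf{S}_i-\mathbf{D}\mathbf{X}_i\|_F^2$. $\nabla_D f_i$ and $\nabla_{X_i}f_i$ denote the partial gradients. **Stationary solution.** $(\mathbf{D}^*,\mathbf{X}^* )$ with $\mathbf{D}^*\in\mathcal{D}$ is a stationary solution of (P2) (equivalently of (P1)) if, for all $\mathbf{D}\in\mathcal{D}$ and all $\mathbf{X}=[\mathbf{X}_1,\ldots,\mathbf{X}_I]$,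 $$\sum_{i=1}^I\Big[\langle\nabla_D f_i(\mathbf{D}^*,\mathbf{X}_i^* ),\mathbf{D}-\mathbf{D}^*\rangle+\langle\nabla_{X_i}f_i(\mathbf{D}^*,\mathbf{X}_i^* ),\mathbf{X}_i-\mathbf{X}_i^*\rangle+g(\mathbf{X}_i)-g(\mathbf{X}_i^* )\Big]\ge0,$$ where $g(\mathbf{X}_i)=\lambda\|\mathbf{X}_i\|_{1,1}+\mu\|\mathbf{X}_i\|_F^2$. **Network.** At each time $\nu=0,1,2,\ldots$ the $I$ agents form a digraph $\mathcal{G}^\nu=(\mathcal{V},\mathcal{E}^\nu)$ with $\mathcal{V}=\{1,\ldots,I\}$, where $(i,j)\in\mathcal{E}^\nu$ means there is a link from $j$ to $i$. The in-neighborhood of $i$ is $\mathcal{N}_i^\nu=\{j:(i,j)\in\mathcal{E}^\nu\}\cup\{i\}$. **D$^2$L algorithm.** Parameters: step-sizes $\gamma^\nu>0$, proximal coefficients $\tau_{D,i}^\nu,\tau_{X,i}^\nu>0$, and weights $w_{ij}^\nu$. Initialization: for all $i$, $\mathbf{X}_i^0=\mathbf{0}$, $\mathbf{D}_{(i)}^0\in\mathcal{D}$ arbitrary, $\boldsymbol{\Theta}_i^0=\nabla_D f_i(\mathbf{D}_{(i)}^0,\mathbf{X}_i^0)$, and $\widetilde{\boldsymbol{\Pi}}_i^0=I\cdot\boldsymbol{\Theta}_i^0-\nabla_D f_i(\mathbf{D}_{(i)}^0,\mathbf{X}_i^0)$. For $\nu=0,1,2,\ldots$ (without termination), every agent $i=1,\ldots,I$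 computes, in this order: 1. $\displaystyle\widetilde{\mathbf{D}}_{(i)}^\nu=\operatorname*{argmin}_{\mathbf{D}\in\mathcal{D}}\ f_i(\mathbf{D},\mathbf{X}_i^\nu)+\frac{\tau_{D,i}^\nu}{2}\|\mathbf{D}-\mathbf{D}_{(i)}^\nu\|_F^2+\langle\widetilde{\boldsymbol{\Pi}}_i^\nu,\mathbf{D}-\mathbf{D}_{(i)}^\nu\rangle$; 2. $\mathbf{U}_{(i)}^\nu=\mathbf{D}_{(i)}^\nu+\gamma^\nu(\widetilde{\mathbf{D}}_{(i)}^\nu-\mathbf{D}_{(i)}^\nu)$; 3. $\displaystyle\mathbf{X}_i^{\nu+1}=\operatorname*{argmin}_{\mathbf{X}_i\in\mathbb{R}^{K\times n_i}}\ f_i(\mathbf{U}_{(i)}^\nu,\mathbf{X}_i)+\frac{\tau_{X,i}^\nu}{2}\|\mathbf{X}_i-\mathbf{X}_i^\nu\|_F^2+\lambda\|\mathbf{X}_i\|_{1,1}+\mu\|\mathbf{X}_i\|_F^2$; 4. $\displaystyle\mathbf{D}_{(i)}^{\nu+1}=\sum_{j\in\mathcal{N}_i^\nu}w_{ij}^\nu\,\mathbf{U}_{(j)}^\nu$; 5. $\displaystyle\boldsymbol{\Theta}_i^{\nu+1}=\sum_{j\in\mathcal{N}_i^\nu}w_{ij}^\nu\,\boldsymbol{\Theta}_j^\nu+\nabla_D f_i(\mathbf{D}_{(i)}^{\nu+1},\mathbf{X}_i^{\nu+1})-\nabla_D f_i(\mathbf{D}_{(i)}^\nu,\mathbf{X}_i^\nu)$;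 6. $\widetilde{\boldsymbol{\Pi}}_i^{\nu+1}=I\cdot\boldsymbol{\Theta}_i^{\nu+1}-\nabla_D f_i(\mathbf{D}_{(i)}^{\nu+1},\mathbf{X}_i^{\nu+1})$. **Assumption A (network connectivity).** The sequence of graphs is $B$-strongly connected: there exists a finite integer $B>0$ such that for every $k\ge0$ the digraph with vertex set $\mathcal{V}$ and edge set $\bigcup_{\nu=kB}^{(k+1)B-1}\mathcal{E}^\nu$ is strongly connected. **Assumption B (weights).** The matrices $\mathbf{W}^\nu=(w_{ij}^\nu)_{i,j=1}^I$ satisfy: (i) there is $\vartheta\in(0,1)$ such that for every $\nu\ge0$ and all $i,j$, $w_{ij}^\nu\in[\vartheta,1]$ if $j\in\mathcal{N}_i^\nu$ and $w_{ij}^\nu=0$ otherwise; (ii) $\mathbf{W}^\nu\mathbf{1}=\mathbf{1}$; (iii) $\mathbf{1}^T\mathbf{W}^\nu=\mathbf{1}^T$. **Assumption C (free parameters).** (C1) $\gamma^\nu\in[0,1]$ for all $\nu\ge1$, $\sum_{\nu=1}^\infty\gamma^\nu=\infty$ and $\sum_{\nu=1}^\infty(\gamma^\nu)^2<\infty$. (C2) For all $i$, the sequences $\{\tau_{X,i}^\nu\}_\nu$ and $\{\tau_{D,i}^\nu\}_\nu$ are bounded and uniformly positive (bounded below by a positive constant); additionally $\tau_{X,i}^\nu=\max(\epsilon,\sigma_{\max}(\mathbf{U}_{(i)}^\nu)^2)$, where $\epsilon>0$ is arbitrary and $\sigma_{\max}(\cdot)$ denotes the maximum singular value. *)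

theory Defs
  imports "HOL-Analysis.Analysis"
begin

text \<open>
  An \<open>a \<times> b\<close> real matrix is a vector of type \<open>real^'b^'a\<close>, so that \<open>norm\<close> and \<open>\<bullet>\<close> are the
  Frobenius norm and the inner product \<open>tr(A\<^sup>T B)\<close>, see the first two lemmas.

  Agents are the elements of the finite type \<open>'i\<close>, and \<open>I = CARD('i)\<close>.  The \<open>N\<close> columns of \<open>S\<close>
  and \<open>X\<close> are indexed by \<open>'n\<close>, and \<open>blk :: 'n \<Rightarrow> 'i\<close> maps a column to the agent that owns it; thus
  \<open>n\<^sub>i = card (blk -` {i})\<close>, which is positive for every \<open>i\<close> iff \<open>blk\<close> is surjective.
  As the \<open>n\<^sub>i\<close> may differ, an \<open>a \<times> n\<^sub>i\<close> matrix is represented as an \<open>a \<times> N\<close> matrix that vanishes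
  outside the columns of agent \<open>i\<close>.  This zero padding preserves norms, inner products and
  products with a matrix on the left.
\<close>

lemma inner_matrix_eq_trace:
  fixes A B :: "real^'b^'a"
  shows "A \<bullet> B = trace (transpose A ** B)"
  unfolding trace_def transpose_def matrix_matrix_mult_def inner_vec_def
  by (simp, rule sum.swap)

lemma norm_matrix_eq_frobenius:
  fixes A :: "real^'b^'a"
  shows "norm A = sqrt (\<Sum>i\<in>UNIV. \<Sum>j\<in>UNIV. (A $ i $ j)\<^sup>2)"
  by (simp add: norm_eq_sqrt_inner inner_vec_def power2_eq_square)

definition block_space :: "('n \<Rightarrow> 'i) \<Rightarrow> 'i \<Rightarrow> (real^'n^'a) set" where
  "block_space blk i = {A. \<forall>r c. blk c \<noteq> i \<longrightarrow> A $ r $ c = 0}"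

definition block :: "('n \<Rightarrow> 'i) \<Rightarrow> real^'n^'a \<Rightarrow> 'i \<Rightarrow> real^'n^'a" where
  "block blk A i = (\<chi> r c. if blk c = i then A $ r $ c else 0)"

text \<open>The concatenation \<open>[X\<^sub>1, \<dots>, X\<^sub>I]\<close>.\<close>

definition hcat :: "('n \<Rightarrow> 'i) \<Rightarrow> ('i \<Rightarrow> real^'n^'a) \<Rightarrow> real^'n^'a" where
  "hcat blk Y = (\<chi> r c. Y (blk c) $ r $ c)"

lemma block_in_block_space: "block blk A i \<in> block_space blk i"
  by (simp add: block_def block_space_def)

lemma hcat_block: "hcat blk (block blk A) = A"
  by (simp add: hcat_def block_def vec_eq_iff)

lemma block_hcat: "(\<And>i. Y i \<in> block_space blk i) \<Longrightarrow> block blk (hcat blk Y) i = Y i"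
  by (auto simp: hcat_def block_def block_space_def vec_eq_iff)

definition norm11 :: "real^'b^'a \<Rightarrow> real" where
  "norm11 A = (\<Sum>i\<in>UNIV. \<Sum>j\<in>UNIV. \<bar>A $ i $ j\<bar>)"

definition reg :: "real \<Rightarrow> real \<Rightarrow> real^'b^'a \<Rightarrow> real" where
  "reg lam \<mu> A = lam * norm11 A + \<mu> * (norm A)\<^sup>2"

definition dict_set :: "real \<Rightarrow> (real^'k^'m) set" where
  "dict_set \<alpha> = {D. \<forall>k. norm (D *v axis k 1) \<le> \<alpha>}"

text \<open>\<open>f\<^sub>i\<close> is \<open>fit S\<^sub>i\<close> and, with \<open>X = [X\<^sub>1, \<dots>, X\<^sub>I]\<close>, \<open>fit S D X\<close> is \<open>\<Sum>\<^sub>i f\<^sub>i(D, X\<^sub>i)\<close>.\<close>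

definition fit :: "real^'n^'m \<Rightarrow> real^'k^'m \<Rightarrow> real^'n^'k \<Rightarrow> real" where
  "fit T D Y = 1 / 2 * (norm (T - D ** Y))\<^sup>2"

definition grad :: "('a::real_inner \<Rightarrow> real) \<Rightarrow> 'a \<Rightarrow> 'a" where
  "grad h x = (THE d. GDERIV h x :> d)"

definition grad_D :: "real^'n^'m \<Rightarrow> real^'k^'m \<Rightarrow> real^'n^'k \<Rightarrow> real^'k^'m" where
  "grad_D T D Y = grad (\<lambda>D'. fit T D' Y) D"

text \<open>
  For \<open>T\<close> and \<open>Y\<close> in the \<open>i\<close>-th block space, this gradient over all of \<open>real^'n^'k\<close> equals
  \<open>D\<^sup>T (D Y - T)\<close>, lies in the \<open>i\<close>-th block space, and hence is the zero-padded gradient over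
  the \<open>K \<times> n\<^sub>i\<close> matrices.
\<close>

definition grad_X :: "real^'n^'m \<Rightarrow> real^'k^'m \<Rightarrow> real^'n^'k \<Rightarrow> real^'n^'k" where
  "grad_X T D Y = grad (\<lambda>Y'. fit T D Y') Y"

text \<open>
  First-order stationarity of \<open>\<Sum>\<^sub>i f\<^sub>i(D, X\<^sub>i) + g(X\<^sub>i)\<close>, and then the same variational inequality
  for the equivalent problem in the undivided variable \<open>X\<close>.
\<close>

definition stationary_blockwise ::
  "('n \<Rightarrow> 'i::finite) \<Rightarrow> real^'n^'m \<Rightarrow> real \<Rightarrow> real \<Rightarrow> real \<Rightarrow> real^'k^'m \<Rightarrow> real^'n^'k \<Rightarrow> bool"
where
  "stationary_blockwise blk S lam \<mu> \<alpha> Ds Xs \<longleftrightarrow>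
     Ds \<in> dict_set \<alpha> \<and>
     (\<forall>D\<in>dict_set \<alpha>. \<forall>X.
        (\<Sum>i\<in>UNIV.
            grad_D (block blk S i) Ds (block blk Xs i) \<bullet> (D - Ds)
          + grad_X (block blk S i) Ds (block blk Xs i) \<bullet> (block blk X i - block blk Xs i)
          + reg lam \<mu> (block blk X i) - reg lam \<mu> (block blk Xs i)) \<ge> 0)"

definition stationary_joint ::
  "real^'n^'m \<Rightarrow> real \<Rightarrow> real \<Rightarrow> real \<Rightarrow> real^'k^'m \<Rightarrow> real^'n^'k \<Rightarrow> bool"
where
  "stationary_joint S lam \<mu> \<alpha> Ds Xs \<longleftrightarrow>
     Ds \<in> dict_set \<alpha> \<and>
     (\<forall>D\<in>dict_set \<alpha>. \<forall>X.
        grad_D S Ds Xs \<bullet> (D - Ds) + grad_X S Ds Xs \<bullet> (X - Xs)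
        + reg lam \<mu> X - reg lam \<mu> Xs \<ge> 0)"

text \<open>A pair \<open>(i, j)\<close> in the edge set is a link from \<open>j\<close> to \<open>i\<close>.\<close>

definition in_nbhd :: "('i \<times> 'i) set \<Rightarrow> 'i \<Rightarrow> 'i set" where
  "in_nbhd E i = {j. (i, j) \<in> E} \<union> {i}"

definition strongly_connected_graph :: "('i \<times> 'i) set \<Rightarrow> bool" where
  "strongly_connected_graph E \<longleftrightarrow> (\<forall>i j. (i, j) \<in> E\<^sup>*)"

definition B_strongly_connected :: "(nat \<Rightarrow> ('i \<times> 'i) set) \<Rightarrow> bool" where
  "B_strongly_connected E \<longleftrightarrow>
     (\<exists>B>0. \<forall>k. strongly_connected_graph (\<Union>\<nu>\<in>{k * B..<(k + 1) * B}. E \<nu>))"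

definition admissible_weights ::
  "(nat \<Rightarrow> ('i::finite \<times> 'i) set) \<Rightarrow> (nat \<Rightarrow> real^'i^'i) \<Rightarrow> bool"
where
  "admissible_weights E W \<longleftrightarrow>
     (\<exists>\<theta>. 0 < \<theta> \<and> \<theta> < 1 \<and>
        (\<forall>\<nu> i j. (j \<in> in_nbhd (E \<nu>) i \<longrightarrow> \<theta> \<le> W \<nu> $ i $ j \<and> W \<nu> $ i $ j \<le> 1) \<and>
                 (j \<notin> in_nbhd (E \<nu>) i \<longrightarrow> W \<nu> $ i $ j = 0))) \<and>
     (\<forall>\<nu>. W \<nu> *v 1 = 1) \<and>
     (\<forall>\<nu>. 1 v* W \<nu> = 1)"

text \<open>The constraint \<open>\<gamma>\<^sup>\<nu> \<le> 1\<close> and both series start at \<open>\<nu> = 1\<close>.\<close>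

definition admissible_steps :: "(nat \<Rightarrow> real) \<Rightarrow> bool" where
  "admissible_steps \<gamma> \<longleftrightarrow>
     (\<forall>\<nu>\<ge>1. 0 \<le> \<gamma> \<nu> \<and> \<gamma> \<nu> \<le> 1) \<and>
     filterlim (\<lambda>n. \<Sum>\<nu>=1..n. \<gamma> \<nu>) at_top sequentially \<and>
     summable (\<lambda>\<nu>. (\<gamma> (Suc \<nu>))\<^sup>2)"

definition bounded_uniformly_positive :: "(nat \<Rightarrow> real) \<Rightarrow> bool" where
  "bounded_uniformly_positive t \<longleftrightarrow> bounded (range t) \<and> (\<exists>c>0. \<forall>\<nu>. c \<le> t \<nu>)"

definition singular_values :: "real^'b^'a \<Rightarrow> real set" where
  "singular_values A = {sqrt l |l. \<exists>v. v \<noteq> 0 \<and> (transpose A ** A) *v v = l *\<^sub>R v}"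

definition sigma_max :: "real^'b^'a \<Rightarrow> real" where
  "sigma_max A = Max (singular_values A)"

text \<open>
  The sequences \<open>D, Dt, U, X, \<Theta>, Pt\<close> (first argument: iteration, second: agent) are a run of the
  algorithm; \<open>Dt\<close> is usually written D with a tilde, and \<open>Pt\<close> Pi with a tilde.  Both subproblems are
  strongly convex when \<open>\<tau>D, \<tau>X, \<mu> > 0\<close>, so \<open>is_arg_min\<close> determines \<open>Dt \<nu> i\<close> and \<open>X (Suc \<nu>) i\<close> uniquely.
\<close>

definition d2l_run ::
  "('n \<Rightarrow> 'i::finite) \<Rightarrow> real^'n^'m \<Rightarrow> real \<Rightarrow> real \<Rightarrow> real
   \<Rightarrow> (nat \<Rightarrow> ('i \<times> 'i) set) \<Rightarrow> (nat \<Rightarrow> real^'i^'i)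
   \<Rightarrow> (nat \<Rightarrow> real) \<Rightarrow> (nat \<Rightarrow> 'i \<Rightarrow> real) \<Rightarrow> (nat \<Rightarrow> 'i \<Rightarrow> real)
   \<Rightarrow> (nat \<Rightarrow> 'i \<Rightarrow> real^'k^'m) \<Rightarrow> (nat \<Rightarrow> 'i \<Rightarrow> real^'k^'m) \<Rightarrow> (nat \<Rightarrow> 'i \<Rightarrow> real^'k^'m)
   \<Rightarrow> (nat \<Rightarrow> 'i \<Rightarrow> real^'n^'k)
   \<Rightarrow> (nat \<Rightarrow> 'i \<Rightarrow> real^'k^'m) \<Rightarrow> (nat \<Rightarrow> 'i \<Rightarrow> real^'k^'m) \<Rightarrow> bool"
where
  "d2l_run blk S lam \<mu> \<alpha> E W \<gamma> \<tau>D \<tau>X D Dt U X \<Theta> Pt \<longleftrightarrow>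
     (\<forall>i. X 0 i = 0 \<and>
          D 0 i \<in> dict_set \<alpha> \<and>
          \<Theta> 0 i = grad_D (block blk S i) (D 0 i) (X 0 i) \<and>
          Pt 0 i = of_nat CARD('i) *\<^sub>R \<Theta> 0 i - grad_D (block blk S i) (D 0 i) (X 0 i)) \<and>
     (\<forall>\<nu> i.
        is_arg_min
          (\<lambda>D'. fit (block blk S i) D' (X \<nu> i) + \<tau>D \<nu> i / 2 * (norm (D' - D \<nu> i))\<^sup>2
                + Pt \<nu> i \<bullet> (D' - D \<nu> i))
          (\<lambda>D'. D' \<in> dict_set \<alpha>)
          (Dt \<nu> i) \<and>
        U \<nu> i = D \<nu> i + \<gamma> \<nu> *\<^sub>R (Dt \<nu> i - D \<nu> i) \<and>
        is_arg_min
          (\<lambda>Y. fit (block blk S i) (U \<nu> i) Y + \<tau>X \<nu> i / 2 * (norm (Y - X \<nu> i))\<^sup>2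
               + lam * norm11 Y + \<mu> * (norm Y)\<^sup>2)
          (\<lambda>Y. Y \<in> block_space blk i)
          (X (Suc \<nu>) i) \<and>
        D (Suc \<nu>) i = (\<Sum>j\<in>in_nbhd (E \<nu>) i. W \<nu> $ i $ j *\<^sub>R U \<nu> j) \<and>
        \<Theta> (Suc \<nu>) i =
          (\<Sum>j\<in>in_nbhd (E \<nu>) i. W \<nu> $ i $ j *\<^sub>R \<Theta> \<nu> j)
          + grad_D (block blk S i) (D (Suc \<nu>) i) (X (Suc \<nu>) i)
          - grad_D (block blk S i) (D \<nu> i) (X \<nu> i) \<and>
        Pt (Suc \<nu>) i =
          of_nat CARD('i) *\<^sub>R \<Theta> (Suc \<nu>) i
          - grad_D (block blk S i) (D (Suc \<nu>) i) (X (Suc \<nu>) i))"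

definition average :: "('i::finite \<Rightarrow> 'a::real_vector) \<Rightarrow> 'a" where
  "average Y = (1 / of_nat CARD('i)) *\<^sub>R (\<Sum>i\<in>UNIV. Y i)"

definition limit_point :: "(nat \<Rightarrow> 'a::topological_space) \<Rightarrow> 'a \<Rightarrow> bool" where
  "limit_point s l \<longleftrightarrow> (\<exists>r. strict_mono r \<and> (s \<circ> r) \<longlonglongrightarrow> l)"

end

theory Submission
  imports Defs
begin

text \<open>
  The codes \<open>X\<^sub>i\<close> are eliminated.  For a fixed dictionary \<open>D\<close> the optimal code \<open>xhat D\<close> of each agent
  solves a strongly convex problem; it is bounded and Lipschitz in \<open>D\<close>, and the proximal step for the
  codes is a contraction with this fixed point (\<open>xhat_lipschitz\<close>, \<open>prox_step_contracts\<close>).  Hence the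
  codes lag behind the moving optimal codes by an error governed by the speed of the dictionaries.
  What remains is an inexact descent method for the function \<open>opt_value\<close>, the objective minimized
  over the codes, whose gradient \<open>H\<close> is evaluated at the average dictionary.

  All errors are controlled in one class, the square-summable sequences, which contains the step
  sizes \<open>\<gamma>\<close> and is closed under contractive recursions (\<open>square_summable_recursion\<close>).  Products of
  mixing matrices over a fixed period have entries bounded away from 0, so mixing contracts
  deviations from the average, and deviations driven by square-summable perturbations are
  square-summable (\<open>consensus\<close>).  This applies to the dictionaries, which gives the consensus claim.
  The contraction of the codes then makes their errors square-summable, too (\<open>code_error\<close>), and
  consensus applies again to the gradient trackers \<open>\<Theta>\<close>, whose average is exactly the average local
  gradient.  So the gradients used by the agents differ from \<open>H\<close> by a
  square-summable \<open>tracking_error\<close>.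

  Optimality of the dictionary step makes \<open>Dt - D\<close> a descent direction up to these errors, and an
  error of type \<open>\<gamma>\<close> times square-summable is summable.  Since \<open>opt_value\<close> is nonnegative,
  \<open>\<gamma> \<parallel>Dt - D\<parallel>\<^sup>2\<close> is summable (\<open>summable_displacement\<close>).  Fix a feasible \<open>Z\<close> and let \<open>p\<close> be the
  violation, at the average dictionary, of the stationarity inequality tested with \<open>Z\<close>.  It
  is bounded by \<open>\<parallel>Dt - D\<parallel>\<close> plus square-summable errors, so \<open>\<gamma> p\<^sup>2\<close> is summable, and it changes by at
  most a multiple of \<open>\<gamma>\<close> per step.  This forces \<open>p\<close> to tend to 0 along the whole sequence
  (\<open>slowly_varying_tendsto_zero\<close>), so the inequality holds at every limit point; there the
  codes are optimal because the code error tends to 0.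

  The step size at time 0 is not bounded by 1, so the dictionaries may leave the feasible set in the
  first step.  They return to it at the rate \<open>\<Prod>(1 - \<gamma>)\<close>, which tends to 0 as \<open>\<gamma>\<close> is not summable, and
  the resulting error in the descent, \<open>\<gamma> \<Prod>(1 - \<gamma>)\<close>, telescopes (\<open>near_feasible\<close>,
  \<open>summable_infeasibility\<close>).
\<close>

section \<open>Square-summable sequences\<close>

definition square_summable :: "(nat \<Rightarrow> real) \<Rightarrow> bool" where
  "square_summable a \<longleftrightarrow> summable (\<lambda>n. (a n)\<^sup>2)"

lemma square_summable_dominated:
  assumes "square_summable b" and "\<And>n. \<bar>a n\<bar> \<le> b n"
  shows "square_summable a"
  unfolding square_summable_def
proof (rule summable_comparison_test)
  show "\<exists>N. \<forall>n\<ge>N. norm ((a n)\<^sup>2) \<le> (b n)\<^sup>2"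
    using power_mono[OF assms(2), of _ 2] by auto
  show "summable (\<lambda>n. (b n)\<^sup>2)"
    using assms(1) by (simp add: square_summable_def)
qed

lemma square_summable_add:
  assumes "square_summable a" and "square_summable b"
  shows "square_summable (\<lambda>n. a n + b n)"
  unfolding square_summable_def
proof (rule summable_comparison_test)
  have "(a n + b n)\<^sup>2 \<le> 2 * (a n)\<^sup>2 + 2 * (b n)\<^sup>2" for n
    using zero_le_power2[of "a n - b n"] by (simp add: power2_eq_square algebra_simps)
  then show "\<exists>N. \<forall>n\<ge>N. norm ((a n + b n)\<^sup>2) \<le> 2 * (a n)\<^sup>2 + 2 * (b n)\<^sup>2"
    by auto
  show "summable (\<lambda>n. 2 * (a n)\<^sup>2 + 2 * (b n)\<^sup>2)"
    using assms by (intro summable_add summable_mult) (simp_all add: square_summable_def)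
qed

lemma square_summable_cmult:
  "square_summable a \<Longrightarrow> square_summable (\<lambda>n. c * a n)"
  by (simp add: square_summable_def power_mult_distrib summable_mult)

lemma square_summable_sum:
  assumes "finite A" and "\<And>i. i \<in> A \<Longrightarrow> square_summable (a i)"
  shows "square_summable (\<lambda>n. \<Sum>i\<in>A. a i n)"
  using assms by (induction) (auto intro: square_summable_add simp: square_summable_def[of "\<lambda>_. 0"])

lemma square_summable_shift:
  "square_summable a \<Longrightarrow> square_summable (\<lambda>n. a (n + k))"
  using summable_ignore_initial_segment[of "\<lambda>n. (a n)\<^sup>2" k] by (simp add: square_summable_def)

lemma square_summable_tendsto_zero:
  assumes "square_summable a"
  shows "a \<longlonglongrightarrow> 0"
proof -
  have "(\<lambda>n. (a n)\<^sup>2) \<longlonglongrightarrow> 0"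
    using assms summable_LIMSEQ_zero unfolding square_summable_def by blast
  from tendsto_real_sqrt[OF this] show ?thesis
    by (simp add: tendsto_rabs_zero_iff)
qed

lemma summable_mult_square_summable:
  assumes "square_summable a" and "square_summable b"
  shows "summable (\<lambda>n. a n * b n)"
proof (rule summable_comparison_test)
  have "\<bar>a n * b n\<bar> \<le> (a n)\<^sup>2 + (b n)\<^sup>2" for n
  proof -
    have "2 * (\<bar>a n\<bar> * \<bar>b n\<bar>) \<le> (a n)\<^sup>2 + (b n)\<^sup>2"
      using zero_le_power2[of "\<bar>a n\<bar> - \<bar>b n\<bar>"] by (simp add: power2_diff)
    moreover have "0 \<le> \<bar>a n\<bar> * \<bar>b n\<bar>"
      by simp
    ultimately show ?thesis
      unfolding abs_mult by linarith
  qed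
  then show "\<exists>N. \<forall>n\<ge>N. norm (a n * b n) \<le> (a n)\<^sup>2 + (b n)\<^sup>2"
    by auto
  show "summable (\<lambda>n. (a n)\<^sup>2 + (b n)\<^sup>2)"
    using assms by (intro summable_add) (simp_all add: square_summable_def)
qed

text \<open>
  The gap \<open>T\<close> is the number of steps after which the network contracts; for the codes it is 1.
\<close>

lemma square_summable_recursion:
  assumes nonneg: "\<And>n. 0 \<le> a n" and q: "0 \<le> q" "q < 1"
    and step: "\<And>n. a (n + T) \<le> q * a n + c n"
    and c: "square_summable c"
  shows "square_summable a"
proof -
  define K where "K = (\<Sum>n<T. (a n)\<^sup>2) + (\<Sum>n. (c n)\<^sup>2) / (1 - q)"
  \<comment> \<open>Convexity of the square, at the point \<open>q a + (1 - q) (c / (1 - q))\<close>.\<close>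
  have square_step: "(a (n + T))\<^sup>2 \<le> q * (a n)\<^sup>2 + (c n)\<^sup>2 / (1 - q)" for n
  proof -
    have "(a (n + T))\<^sup>2 \<le> (q * a n + c n)\<^sup>2"
      using step nonneg by (intro power_mono)
    also have "\<dots> \<le> q * (a n)\<^sup>2 + (c n)\<^sup>2 / (1 - q)"
    proof -
      have "(1 - q) * (q * (a n)\<^sup>2) + (c n)\<^sup>2 - (1 - q) * (q * a n + c n)\<^sup>2
          = q * ((1 - q) * a n - c n)\<^sup>2"
        by algebra
      moreover have "0 \<le> q * ((1 - q) * a n - c n)\<^sup>2"
        using q by simp
      ultimately have "(1 - q) * (q * a n + c n)\<^sup>2 \<le> (1 - q) * (q * (a n)\<^sup>2) + (c n)\<^sup>2"
        by linarith
      then have "(1 - q) * (q * a n + c n)\<^sup>2 \<le> (1 - q) * (q * (a n)\<^sup>2 + (c n)\<^sup>2 / (1 - q))"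
        using q by (simp add: distrib_left)
      then show ?thesis using q by simp
    qed
    finally show ?thesis .
  qed
  have bound: "(\<Sum>n<N. (a n)\<^sup>2) \<le> K / (1 - q)" for N
  proof -
    have "(\<Sum>n<N. (a n)\<^sup>2) \<le> (\<Sum>n<T + N. (a n)\<^sup>2)"
      by (rule sum_mono2) auto
    also have "\<dots> = (\<Sum>n<T. (a n)\<^sup>2) + (\<Sum>n<N. (a (n + T))\<^sup>2)"
      by (induction N) (simp_all add: add.commute)
    also have "(\<Sum>n<N. (a (n + T))\<^sup>2) \<le> (\<Sum>n<N. q * (a n)\<^sup>2 + (c n)\<^sup>2 / (1 - q))"
      by (rule sum_mono) (rule square_step)
    also have "\<dots> = q * (\<Sum>n<N. (a n)\<^sup>2) + (\<Sum>n<N. (c n)\<^sup>2) / (1 - q)"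
      by (simp add: sum.distrib sum_distrib_left sum_divide_distrib)
    also have "(\<Sum>n<N. (c n)\<^sup>2) / (1 - q) \<le> (\<Sum>n. (c n)\<^sup>2) / (1 - q)"
      using c q by (intro divide_right_mono sum_le_suminf) (auto simp: square_summable_def)
    finally have "(1 - q) * (\<Sum>n<N. (a n)\<^sup>2) \<le> K"
      by (simp add: K_def algebra_simps)
    then show ?thesis
      using q by (simp add: pos_le_divide_eq mult.commute)
  qed
  show ?thesis
    unfolding square_summable_def
    by (rule bounded_imp_summable[of _ "K / (1 - q)"])
       (use bound[of "Suc _"] in \<open>simp_all add: lessThan_Suc_atMost\<close>)
qed

text \<open>
  A quantity that is bounded below and decreases by \<open>a\<close> up to a summable error can pay for only
  finitely much \<open>a\<close>.
\<close>

lemma summable_of_decrease: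
  fixes a v e :: "nat \<Rightarrow> real"
  assumes "\<And>n. 0 \<le> a n" and v: "\<And>n. 0 \<le> v n" and e: "\<And>n. 0 \<le> e n" "summable e"
    and step: "\<And>n. a n \<le> v n - v (Suc n) + e n"
  shows "summable a"
proof (rule bounded_imp_summable)
  fix N
  have "(\<Sum>n\<le>N. a n) \<le> (\<Sum>n\<le>N. v n - v (Suc n)) + (\<Sum>n\<le>N. e n)"
    unfolding sum.distrib[symmetric] by (rule sum_mono) (rule step)
  also have "(\<Sum>n\<le>N. v n - v (Suc n)) \<le> v 0"
    using v[of "Suc N"] by (simp add: sum_telescope)
  also have "(\<Sum>n\<le>N. e n) \<le> suminf e"
    using e by (intro sum_le_suminf) auto
  finally show "(\<Sum>n\<le>N. a n) \<le> v 0 + suminf e"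
    by simp
qed (rule assms)

text \<open>
  Since \<open>\<gamma>\<close> is not summable, summability of \<open>\<gamma> p\<^sup>2\<close> gives only \<open>liminf p = 0\<close>.  That \<open>p\<close> moves
  by at most \<open>C \<gamma>\<close> per step excludes oscillation: the increments of \<open>p\<^sup>3\<close> are of order
  \<open>p\<^sup>2 \<gamma> + \<gamma>\<^sup>3\<close>, hence summable, so \<open>p\<close> converges, and 0 is the only possible limit.
\<close>

lemma slowly_varying_tendsto_zero:
  fixes p \<gamma> :: "nat \<Rightarrow> real"
  assumes p: "\<And>n. 0 \<le> p n" and \<gamma>: "\<And>n. 0 \<le> \<gamma> n" "\<And>n. \<gamma> n \<le> 1"
    and diverges: "\<not> summable \<gamma>" and \<gamma>2: "square_summable \<gamma>"
    and slow: "\<And>n. \<bar>p (Suc n) - p n\<bar> \<le> C * \<gamma> n"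
    and weighted: "summable (\<lambda>n. \<gamma> n * (p n)\<^sup>2)"
  shows "p \<longlonglongrightarrow> 0"
proof -
  have C\<gamma>: "0 \<le> C * \<gamma> n" for n
    using slow[of n] by linarith
  \<comment> \<open>The cubic error \<open>\<gamma>\<^sup>3\<close> is absorbed into \<open>\<gamma>\<^sup>2\<close>, using \<open>\<gamma> \<le> 1\<close>.\<close>
  have increment: "\<bar>p (Suc n) ^ 3 - p n ^ 3\<bar> \<le> 6 * C * (\<gamma> n * (p n)\<^sup>2) + 6 * C\<^sup>2 * \<bar>C\<bar> * (\<gamma> n)\<^sup>2" for n
  proof -
    let ?a = "p (Suc n)" and ?b = "p n" and ?e = "C * \<gamma> n"
    have ab: "?a \<le> ?b + ?e" using slow[of n] by linarith
    have "?a ^ 3 - ?b ^ 3 = (?a - ?b) * (?a\<^sup>2 + ?a * ?b + ?b\<^sup>2)"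
      by algebra
    then have "\<bar>?a ^ 3 - ?b ^ 3\<bar> = \<bar>?a - ?b\<bar> * (?a\<^sup>2 + ?a * ?b + ?b\<^sup>2)"
      using p[of n] p[of "Suc n"] by (simp add: abs_mult)
    also have "\<dots> \<le> ?e * (3 * (?b + ?e)\<^sup>2)"
    proof (intro mult_mono slow)
      have "?a\<^sup>2 \<le> (?b + ?e)\<^sup>2" "?a * ?b \<le> (?b + ?e) * (?b + ?e)" "?b\<^sup>2 \<le> (?b + ?e)\<^sup>2"
        using ab p[of n] p[of "Suc n"] C\<gamma>[of n] by (auto intro!: power_mono mult_mono)
      then show "?a\<^sup>2 + ?a * ?b + ?b\<^sup>2 \<le> 3 * (?b + ?e)\<^sup>2"
        by (simp add: power2_eq_square)
    qed (use p[of n] p[of "Suc n"] C\<gamma>[of n] in auto)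
    also have "\<dots> \<le> ?e * (6 * ?b\<^sup>2 + 6 * ?e\<^sup>2)"
    proof (intro mult_left_mono C\<gamma>)
      show "3 * (?b + ?e)\<^sup>2 \<le> 6 * ?b\<^sup>2 + 6 * ?e\<^sup>2"
        using zero_le_power2[of "?b - ?e"] by (simp add: power2_eq_square algebra_simps)
    qed
    also have "\<dots> = 6 * C * (\<gamma> n * ?b\<^sup>2) + 6 * C\<^sup>2 * (C * \<gamma> n) * (\<gamma> n)\<^sup>2"
      by algebra
    also have "\<dots> \<le> 6 * C * (\<gamma> n * ?b\<^sup>2) + 6 * C\<^sup>2 * \<bar>C\<bar> * (\<gamma> n)\<^sup>2"
    proof -
      have "C * \<gamma> n \<le> \<bar>C\<bar> * 1"
        using \<gamma>[of n] by (intro mult_mono) auto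
      then show ?thesis
        by (intro add_left_mono mult_right_mono mult_left_mono) auto
    qed
    finally show ?thesis .
  qed
  have "summable (\<lambda>n. p (Suc n) ^ 3 - p n ^ 3)"
  proof (rule summable_comparison_test)
    show "\<exists>N. \<forall>n\<ge>N. norm (p (Suc n) ^ 3 - p n ^ 3)
        \<le> 6 * C * (\<gamma> n * (p n)\<^sup>2) + 6 * C\<^sup>2 * \<bar>C\<bar> * (\<gamma> n)\<^sup>2"
      using increment by auto
    show "summable (\<lambda>n. 6 * C * (\<gamma> n * (p n)\<^sup>2) + 6 * C\<^sup>2 * \<bar>C\<bar> * (\<gamma> n)\<^sup>2)"
      using weighted \<gamma>2 by (intro summable_add summable_mult) (simp_all add: square_summable_def)
  qed
  then have "convergent (\<lambda>n. \<Sum>k<n. p (Suc k) ^ 3 - p k ^ 3)"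
    by (simp add: summable_iff_convergent)
  then have "convergent (\<lambda>n. p n ^ 3 - p 0 ^ 3)"
    unfolding sum_lessThan_telescope[of "\<lambda>n. p n ^ 3"] .
  then obtain l where "(\<lambda>n. p n ^ 3 - p 0 ^ 3) \<longlonglongrightarrow> l"
    by (auto simp: convergent_def)
  from tendsto_add[OF this tendsto_const[of "p 0 ^ 3"]]
  have cube: "(\<lambda>n. p n ^ 3) \<longlonglongrightarrow> l + p 0 ^ 3" by simp
  define L where "L = root 3 (l + p 0 ^ 3)"
  have lim: "p \<longlonglongrightarrow> L"
    using tendsto_real_root[OF cube, of 3] by (simp add: L_def odd_real_root_power_cancel)
  have "L = 0"
  proof (rule ccontr)
    assume "L \<noteq> 0"
    then have "L\<^sup>2 / 2 < L\<^sup>2" "0 < L\<^sup>2" by simp_all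
    moreover have "(\<lambda>n. (p n)\<^sup>2) \<longlonglongrightarrow> L\<^sup>2"
      using lim by (intro tendsto_intros)
    ultimately have "eventually (\<lambda>n. L\<^sup>2 / 2 < (p n)\<^sup>2) sequentially"
      using order_tendstoD(1) by blast
    then have "eventually (\<lambda>n. norm (\<gamma> n) \<le> 2 / L\<^sup>2 * (\<gamma> n * (p n)\<^sup>2)) sequentially"
    proof (rule eventually_mono)
      fix n assume "L\<^sup>2 / 2 < (p n)\<^sup>2"
      then have "\<gamma> n * (L\<^sup>2 / 2) \<le> \<gamma> n * (p n)\<^sup>2"
        using \<gamma>[of n] by (intro mult_left_mono) auto
      then show "norm (\<gamma> n) \<le> 2 / L\<^sup>2 * (\<gamma> n * (p n)\<^sup>2)"
        using \<gamma>[of n] \<open>0 < L\<^sup>2\<close> by (simp add: field_simps)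
    qed
    then have "summable \<gamma>"
      by (rule summable_comparison_test_ev) (rule summable_mult[OF weighted])
    then show False using diverges by simp
  qed
  then show ?thesis using lim by simp
qed

section \<open>Consensus under doubly stochastic mixing\<close>

lemma norm_average_le:
  fixes y :: "'i::finite \<Rightarrow> 'a::real_normed_vector"
  assumes "\<And>i. norm (y i) \<le> K"
  shows "norm (average y) \<le> K"
proof -
  have "norm (\<Sum>i\<in>UNIV. y i) \<le> of_nat CARD('i) * K"
    using sum_norm_le[of UNIV y "\<lambda>_. K"] assms by simp
  then show ?thesis
    by (simp add: average_def field_simps)
qed

text \<open>
  Connectivity is required of every window of length \<open>B\<close>, not only of the aligned windows from
  \<open>k B\<close> to \<open>(k + 1) B\<close>, which makes the locale invariant under time shifts.
\<close>

locale mixing_weights =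
  fixes W :: "nat \<Rightarrow> real^'i^'i" and E :: "nat \<Rightarrow> ('i \<times> 'i) set" and \<theta> :: real and B :: nat
  assumes \<theta>: "0 < \<theta>" "\<theta> \<le> 1"
    and W_nonneg: "0 \<le> W \<nu> $ i $ j"
    and W_lower: "j \<in> in_nbhd (E \<nu>) i \<Longrightarrow> \<theta> \<le> W \<nu> $ i $ j"
    and W_rows: "(\<Sum>j\<in>UNIV. W \<nu> $ i $ j) = 1"
    and W_cols: "(\<Sum>i\<in>UNIV. W \<nu> $ i $ j) = 1"
    and connected: "strongly_connected_graph (\<Union>\<nu>\<in>{s..<s + B}. E \<nu>)"
begin

lemma norm_mix_le:
  fixes y :: "'i \<Rightarrow> 'a::real_normed_vector"
  assumes "\<And>j. norm (y j) \<le> K"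
  shows "norm (\<Sum>j\<in>UNIV. W \<nu> $ i $ j *\<^sub>R y j) \<le> K"
proof -
  have "norm (\<Sum>j\<in>UNIV. W \<nu> $ i $ j *\<^sub>R y j) \<le> (\<Sum>j\<in>UNIV. W \<nu> $ i $ j * K)"
    by (rule sum_norm_le) (simp add: W_nonneg assms mult_left_mono)
  also have "\<dots> = K"
    by (simp add: sum_distrib_right[symmetric] W_rows)
  finally show ?thesis .
qed

lemma sum_mix:
  fixes y :: "'i \<Rightarrow> 'a::real_vector"
  shows "(\<Sum>i\<in>UNIV. \<Sum>j\<in>UNIV. W \<nu> $ i $ j *\<^sub>R y j) = (\<Sum>j\<in>UNIV. y j)"
  by (subst sum.swap) (simp add: scaleR_left.sum[symmetric] W_cols)

text \<open>
  The product of the mixing matrices from time \<open>s\<close> to time \<open>s + t\<close>.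
\<close>

fun flow :: "nat \<Rightarrow> nat \<Rightarrow> real^'i^'i" where
  "flow s 0 = mat 1"
| "flow s (Suc t) = W (s + t) ** flow s t"

lemma flow_Suc_nth: "flow s (Suc t) $ i $ j = (\<Sum>k\<in>UNIV. W (s + t) $ i $ k * flow s t $ k $ j)"
  by (simp add: matrix_matrix_mult_def)

lemma flow_nonneg: "0 \<le> flow s t $ i $ j"
proof (induction t arbitrary: i)
  case 0
  then show ?case by (simp add: mat_def)
next
  case (Suc t)
  then show ?case unfolding flow_Suc_nth by (intro sum_nonneg mult_nonneg_nonneg W_nonneg)
qed

lemma flow_rows: "(\<Sum>j\<in>UNIV. flow s t $ i $ j) = 1"
proof (induction t arbitrary: i)
  case 0
  then show ?case by (simp add: mat_def)
next
  case (Suc t)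
  then show ?case
    unfolding flow_Suc_nth
    by (subst sum.swap) (simp add: sum_distrib_left[symmetric] W_rows)
qed

lemma flow_step_lower:
  assumes "k \<in> in_nbhd (E (s + t)) i" and "\<theta> ^ t \<le> flow s t $ k $ j"
  shows "\<theta> ^ Suc t \<le> flow s (Suc t) $ i $ j"
proof -
  have "\<theta> ^ Suc t \<le> W (s + t) $ i $ k * flow s t $ k $ j"
    using assms W_lower[OF assms(1)] \<theta> by (auto intro!: mult_mono W_nonneg)
  also have "\<dots> \<le> flow s (Suc t) $ i $ j"
    unfolding flow_Suc_nth
    by (rule member_le_sum) (auto intro!: mult_nonneg_nonneg W_nonneg flow_nonneg)
  finally show ?thesis .
qed

text \<open>
  The agents that the value of \<open>j\<close> at time \<open>s\<close> influences with weight at least \<open>\<theta>\<^sup>t\<close> after \<open>t\<close>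
  steps.
\<close>

definition reached :: "nat \<Rightarrow> 'i \<Rightarrow> nat \<Rightarrow> 'i set" where
  "reached s j t = {i. \<theta> ^ t \<le> flow s t $ i $ j}"

text \<open>
  Every agent is in its own neighbourhood, so what has been reached stays reached.
\<close>

lemma reached_mono: "t \<le> t' \<Longrightarrow> reached s j t \<subseteq> reached s j t'"
proof (induction rule: dec_induct)
  case (step t')
  then show ?case
    using flow_step_lower[of _ s t' _ j] unfolding reached_def in_nbhd_def by blast
qed simp

text \<open>
  Some edge of the window leads from the reached set into its complement.
\<close>

lemma reached_grows:
  assumes "reached s j t \<noteq> UNIV" and "reached s j t \<noteq> {}"
  shows "reached s j t \<subset> reached s j (t + B)"
proof -
  obtain k i where ki: "k \<in> reached s j t" "i \<notin> reached s j t"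
    using assms by blast
  have "(i, k) \<in> (\<Union>\<nu>\<in>{s + t..<s + t + B}. E \<nu>)\<^sup>*"
    using connected[of "s + t"] by (auto simp: strongly_connected_graph_def)
  then have "\<exists>i' k'. i' \<notin> reached s j t \<and> k' \<in> reached s j t
      \<and> (i', k') \<in> (\<Union>\<nu>\<in>{s + t..<s + t + B}. E \<nu>)"
    using ki(2) by (induction rule: converse_rtrancl_induct) (use ki in auto)
  then obtain i' k' \<nu> where edge: "i' \<notin> reached s j t" "k' \<in> reached s j t"
      "s + t \<le> \<nu>" "\<nu> < s + t + B" "(i', k') \<in> E \<nu>"
    by auto
  define u where "u = \<nu> - s"
  have u: "\<nu> = s + u" "t \<le> u" "Suc u \<le> t + B"
    using edge by (auto simp: u_def)
  have "k' \<in> reached s j u"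
    using reached_mono[OF u(2)] edge(2) by blast
  then have "i' \<in> reached s j (Suc u)"
    using flow_step_lower[of k' s u i' j] edge(5) u(1) unfolding reached_def in_nbhd_def by simp
  then have "i' \<in> reached s j (t + B)"
    using reached_mono[OF u(3)] by blast
  then show ?thesis
    using edge(1) reached_mono[of t "t + B"] by auto
qed

lemma reached_card:
  "reached s j (m * B) = UNIV \<or> m < card (reached s j (m * B))"
proof (induction m)
  case 0
  have "j \<in> reached s j 0" by (simp add: reached_def mat_def)
  then show ?case by (auto simp: card_gt_0_iff)
next
  case (Suc m)
  show ?case
  proof (cases "reached s j (m * B) = UNIV")
    case True
    then show ?thesis using reached_mono[of "m * B" "Suc m * B"] by auto
  next
    case False
    then have "m < card (reached s j (m * B))" using Suc by simp
    moreover have "card (reached s j (m * B)) < card (reached s j (m * B + B))"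
      using False calculation by (intro psubset_card_mono reached_grows) auto
    ultimately show ?thesis by (simp add: add.commute)
  qed
qed

definition period :: nat where
  "period = CARD('i) * B"

lemma flow_period_lower: "\<theta> ^ period \<le> flow s period $ i $ j"
proof -
  have "card (reached s j period) \<le> CARD('i)"
    by (rule card_mono) auto
  then have "reached s j period = UNIV"
    using reached_card[of s j "CARD('i)"] by (simp add: period_def)
  then show ?thesis by (auto simp: reached_def)
qed

definition contraction :: real where
  "contraction = 1 - of_nat CARD('i) * \<theta> ^ period"

lemma contraction: "0 \<le> contraction" "contraction < 1"
proof -
  have "(\<Sum>j\<in>(UNIV::'i set). \<theta> ^ period) \<le> (\<Sum>j\<in>UNIV. flow 0 period $ undefined $ j)"
    by (rule sum_mono) (rule flow_period_lower)
  then show "0 \<le> contraction"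
    by (simp add: flow_rows contraction_def)
  show "contraction < 1"
    using \<theta> by (simp add: contraction_def)
qed

text \<open>
  All entries of the product over one period are at least \<open>\<eta> = \<theta> ^ period\<close>.  On vectors of mean
  zero, \<open>\<eta>\<close> can be subtracted from every entry without changing the result; what remains is a
  nonnegative matrix with row sums \<open>1 - CARD('i) \<eta>\<close>.
\<close>

lemma flow_contracts:
  fixes z :: "'i \<Rightarrow> 'a::real_normed_vector"
  assumes mean: "(\<Sum>j\<in>UNIV. z j) = 0" and K: "\<And>j. norm (z j) \<le> K"
  shows "norm (\<Sum>j\<in>UNIV. flow s period $ i $ j *\<^sub>R z j) \<le> contraction * K"
proof -
  let ?\<eta> = "\<theta> ^ period"
  have "(\<Sum>j\<in>UNIV. flow s period $ i $ j *\<^sub>R z j)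
      = (\<Sum>j\<in>UNIV. (flow s period $ i $ j - ?\<eta>) *\<^sub>R z j)"
    by (simp add: scaleR_diff_left sum_subtractf scaleR_right.sum[symmetric] mean)
  also have "norm \<dots> \<le> (\<Sum>j\<in>UNIV. (flow s period $ i $ j - ?\<eta>) * K)"
    by (rule sum_norm_le) (simp add: flow_period_lower K mult_left_mono)
  also have "\<dots> = contraction * K"
    by (simp add: sum_distrib_right[symmetric] sum_subtractf flow_rows contraction_def)
  finally show ?thesis .
qed

lemma flow_perturbed:
  fixes z b :: "nat \<Rightarrow> 'i \<Rightarrow> 'a::real_normed_vector"
  assumes step: "\<And>\<nu> i. z (Suc \<nu>) i = (\<Sum>j\<in>UNIV. W \<nu> $ i $ j *\<^sub>R z \<nu> j) + b \<nu> i"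
    and b: "\<And>\<nu> i. norm (b \<nu> i) \<le> \<beta> \<nu>"
  shows "norm (z (s + t) i - (\<Sum>j\<in>UNIV. flow s t $ i $ j *\<^sub>R z s j)) \<le> (\<Sum>u<t. \<beta> (s + u))"
proof (induction t arbitrary: i)
  case 0
  have "(\<Sum>j\<in>UNIV. (mat 1 :: real^'i^'i) $ i $ j *\<^sub>R z s j) = (\<Sum>j\<in>UNIV. if i = j then z s j else 0)"
    by (intro sum.cong) (auto simp: mat_def)
  then show ?case by simp
next
  case (Suc t)
  have "(\<Sum>j\<in>UNIV. flow s (Suc t) $ i $ j *\<^sub>R z s j)
      = (\<Sum>k\<in>UNIV. W (s + t) $ i $ k *\<^sub>R (\<Sum>j\<in>UNIV. flow s t $ k $ j *\<^sub>R z s j))"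
    unfolding flow_Suc_nth scaleR_left.sum scaleR_right.sum
    by (subst sum.swap) simp
  then have "z (s + Suc t) i - (\<Sum>j\<in>UNIV. flow s (Suc t) $ i $ j *\<^sub>R z s j)
      = (\<Sum>k\<in>UNIV. W (s + t) $ i $ k *\<^sub>R (z (s + t) k - (\<Sum>j\<in>UNIV. flow s t $ k $ j *\<^sub>R z s j)))
        + b (s + t) i"
    by (simp add: step scaleR_diff_right sum_subtractf)
  also have "norm \<dots> \<le> (\<Sum>u<t. \<beta> (s + u)) + \<beta> (s + t)"
    by (intro norm_triangle_mono norm_mix_le Suc b)
  finally show ?case by simp
qed

text \<open>
  Subtracting the average leaves a perturbed mixing of vectors of mean zero, because the columns of
  \<open>W\<close> sum to 1; over each period the largest deviation contracts up to the accumulated perturbation.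
\<close>

theorem consensus:
  fixes y b :: "nat \<Rightarrow> 'i \<Rightarrow> 'a::real_normed_vector"
  assumes step: "\<And>\<nu> i. y (Suc \<nu>) i = (\<Sum>j\<in>UNIV. W \<nu> $ i $ j *\<^sub>R y \<nu> j) + b \<nu> i"
    and b: "\<And>\<nu> i. norm (b \<nu> i) \<le> \<beta> \<nu>" and \<beta>: "square_summable \<beta>"
  shows "square_summable (\<lambda>\<nu>. norm (y \<nu> i - average (y \<nu>)))"
proof -
  define z where "z \<nu> i = y \<nu> i - average (y \<nu>)" for \<nu> i
  define c where "c \<nu> i = b \<nu> i - average (b \<nu>)" for \<nu> i
  define M where "M \<nu> = Max (range (\<lambda>i. norm (z \<nu> i)))" for \<nu>
  have M: "norm (z \<nu> i) \<le> M \<nu>" for \<nu> i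
    by (simp add: M_def)
  have avg_step: "average (y (Suc \<nu>)) = average (y \<nu>) + average (b \<nu>)" for \<nu>
    by (simp add: average_def step sum.distrib sum_mix scaleR_add_right)
  have z_step: "z (Suc \<nu>) i = (\<Sum>j\<in>UNIV. W \<nu> $ i $ j *\<^sub>R z \<nu> j) + c \<nu> i" for \<nu> i
    by (simp add: z_def c_def avg_step step scaleR_diff_right sum_subtractf
        scaleR_left.sum[symmetric] W_rows)
  have mean: "(\<Sum>j\<in>UNIV. z \<nu> j) = 0" for \<nu>
    unfolding z_def sum_subtractf sum_constant_scaleR by (simp add: average_def)
  have "norm (average (b \<nu>)) \<le> \<beta> \<nu>" for \<nu>
    by (rule norm_average_le) (rule b)
  then have c: "norm (c \<nu> i) \<le> 2 * \<beta> \<nu>" for \<nu> i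
    using norm_triangle_ineq4[of "b \<nu> i" "average (b \<nu>)"] b[of \<nu> i]
    unfolding c_def by (smt (verit))
  have "square_summable M"
  proof (rule square_summable_recursion)
    show "0 \<le> M \<nu>" for \<nu>
      using M[of \<nu>] norm_ge_zero order_trans by blast
    show "M (\<nu> + period) \<le> contraction * M \<nu> + (\<Sum>u<period. 2 * \<beta> (\<nu> + u))" for \<nu>
    proof -
      have "norm (z (\<nu> + period) i) \<le> contraction * M \<nu> + (\<Sum>u<period. 2 * \<beta> (\<nu> + u))" for i
        using norm_triangle_sub[of "z (\<nu> + period) i" "\<Sum>j\<in>UNIV. flow \<nu> period $ i $ j *\<^sub>R z \<nu> j"]
          flow_perturbed[of z c "\<lambda>\<nu>. 2 * \<beta> \<nu>", OF z_step c, of \<nu> period i]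
          flow_contracts[of "z \<nu>" "M \<nu>" \<nu> i, OF mean M]
        by linarith
      then show ?thesis by (simp add: M_def[of "\<nu> + period"])
    qed
    show "square_summable (\<lambda>\<nu>. \<Sum>u<period. 2 * \<beta> (\<nu> + u))"
      by (intro square_summable_sum square_summable_cmult square_summable_shift \<beta>) simp
  qed (rule contraction)+
  then show ?thesis
    by (rule square_summable_dominated) (use M in \<open>simp add: z_def\<close>)
qed

end

section \<open>The matrix fit and its gradients\<close>

lemma power2_norm_matrix:
  fixes A :: "real^'b^'a"
  shows "(norm A)\<^sup>2 = (\<Sum>i\<in>UNIV. \<Sum>j\<in>UNIV. (A $ i $ j)\<^sup>2)"
  unfolding norm_matrix_eq_frobenius by (intro real_sqrt_pow2 sum_nonneg zero_le_power2)

lemma norm_matrix_mult_le: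
  fixes A :: "real^'b^'a" and B :: "real^'c^'b"
  shows "norm (A ** B) \<le> norm A * norm B"
proof -
  have "(norm (A ** B))\<^sup>2 = (\<Sum>i\<in>UNIV. \<Sum>j\<in>UNIV. (\<Sum>k\<in>UNIV. A $ i $ k * B $ k $ j)\<^sup>2)"
    by (simp add: power2_norm_matrix matrix_matrix_mult_def)
  also have "\<dots> \<le> (\<Sum>i\<in>UNIV. \<Sum>j\<in>UNIV. (\<Sum>k\<in>UNIV. (A $ i $ k)\<^sup>2) * (\<Sum>k\<in>UNIV. (B $ k $ j)\<^sup>2))"
    by (intro sum_mono Cauchy_Schwarz_ineq_sum)
  also have "\<dots> = (\<Sum>i\<in>UNIV. \<Sum>k\<in>UNIV. (A $ i $ k)\<^sup>2) * (\<Sum>j\<in>UNIV. \<Sum>k\<in>UNIV. (B $ k $ j)\<^sup>2)"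
    by (simp add: sum_product)
  also have "(\<Sum>j\<in>UNIV. \<Sum>k\<in>UNIV. (B $ k $ j)\<^sup>2) = (norm B)\<^sup>2"
    unfolding power2_norm_matrix by (rule sum.swap)
  finally have "(norm (A ** B))\<^sup>2 \<le> (norm A * norm B)\<^sup>2"
    by (simp add: power2_norm_matrix power_mult_distrib)
  then show ?thesis
    by (rule power2_le_imp_le) simp
qed

lemma bounded_bilinear_matrix_mult:
  "bounded_bilinear ((**) :: real^'b^'a \<Rightarrow> real^'c^'b \<Rightarrow> real^'c^'a)"
proof
  show "\<exists>K. \<forall>(A :: real^'b^'a) (B :: real^'c^'b). norm (A ** B) \<le> norm A * norm B * K"
    by (rule exI[of _ 1]) (simp add: norm_matrix_mult_le)
qed (simp_all add: matrix_matrix_mult_def vec_eq_iff sum.distrib sum_distrib_left algebra_simps)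

interpretation matmul: bounded_bilinear "(**) :: real^'b^'a \<Rightarrow> real^'c^'b \<Rightarrow> real^'c^'a"
  by (rule bounded_bilinear_matrix_mult)

lemma transpose_diff: "transpose (A - B) = transpose A - transpose (B :: real^'b^'a)"
  by (simp add: transpose_def vec_eq_iff)

lemma inner_transpose: "transpose A \<bullet> transpose B = A \<bullet> (B :: real^'b^'a)"
  by (simp add: transpose_def inner_vec_def) (rule sum.swap)

lemma norm_transpose: "norm (transpose A) = norm (A :: real^'b^'a)"
  by (simp add: norm_eq_sqrt_inner inner_transpose)

lemma inner_matrix_mult_right:
  fixes A :: "real^'b^'a" and B :: "real^'c^'b"
  shows "(A ** B) \<bullet> C = B \<bullet> (transpose A ** C)"
  by (simp add: inner_matrix_eq_trace matrix_transpose_mul matrix_mul_assoc)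

lemma inner_matrix_mult_left:
  fixes A :: "real^'b^'a" and B :: "real^'c^'b"
  shows "(A ** B) \<bullet> C = A \<bullet> (C ** transpose B)"
proof -
  have "(A ** B) \<bullet> C = (transpose B ** transpose A) \<bullet> transpose C"
    by (metis inner_transpose matrix_transpose_mul)
  also have "\<dots> = transpose A \<bullet> transpose (C ** transpose B)"
    by (simp add: inner_matrix_mult_right matrix_transpose_mul)
  finally show ?thesis by (simp only: inner_transpose)
qed

lemma norm_matrix_mult_diff_le:
  fixes A A' :: "real^'b^'a" and B B' :: "real^'c^'b"
  assumes "norm A \<le> R" and "norm B' \<le> R'"
  shows "norm (A ** B - A' ** B') \<le> R * norm (B - B') + R' * norm (A - A')"
proof -
  have "A ** B - A' ** B' = A ** (B - B') + (A - A') ** B'"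
    by (simp add: matmul.diff_left matmul.diff_right)
  also have "norm \<dots> \<le> norm A * norm (B - B') + norm (A - A') * norm B'"
    by (intro norm_triangle_mono norm_matrix_mult_le)
  also have "\<dots> \<le> R * norm (B - B') + R' * norm (A - A')"
    using assms by (simp add: add_mono mult_right_mono mult_left_mono mult.commute[of _ "norm B'"])
  finally show ?thesis .
qed

lemma power2_norm_add:
  fixes x y :: "'a::real_inner"
  shows "(norm (x + y))\<^sup>2 = (norm x)\<^sup>2 + 2 * (x \<bullet> y) + (norm y)\<^sup>2"
  by (simp add: power2_norm_eq_inner inner_add_left inner_add_right inner_commute)

lemma fit_add_left:
  "fit T (D + H) Y = fit T D Y + ((D ** Y - T) ** transpose Y) \<bullet> H + (norm (H ** Y))\<^sup>2 / 2"
proof -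
  have "norm (T - (D + H) ** Y) = norm ((D ** Y - T) + H ** Y)"
    by (subst norm_minus_commute) (simp add: matmul.add_left algebra_simps)
  moreover have "norm (T - D ** Y) = norm (D ** Y - T)"
    by (rule norm_minus_commute)
  moreover have "(D ** Y - T) \<bullet> (H ** Y) = ((D ** Y - T) ** transpose Y) \<bullet> H"
    by (metis inner_commute inner_matrix_mult_left)
  ultimately show ?thesis
    by (simp add: fit_def power2_norm_add)
qed

lemma fit_add_right:
  "fit T D (Y + H) = fit T D Y + (transpose D ** (D ** Y - T)) \<bullet> H + (norm (D ** H))\<^sup>2 / 2"
proof -
  have "norm (T - D ** (Y + H)) = norm ((D ** Y - T) + D ** H)"
    by (subst norm_minus_commute) (simp add: matmul.add_right algebra_simps)
  moreover have "norm (T - D ** Y) = norm (D ** Y - T)"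
    by (rule norm_minus_commute)
  moreover have "(D ** Y - T) \<bullet> (D ** H) = (transpose D ** (D ** Y - T)) \<bullet> H"
    by (metis inner_commute inner_matrix_mult_right)
  ultimately show ?thesis
    by (simp add: fit_def power2_norm_add)
qed

text \<open>
  For a function that is quadratic up to an error of order two, \<open>grad\<close> can be read off from the
  expansion.
\<close>

lemma grad_eqI:
  fixes h :: "'a::real_inner \<Rightarrow> real"
  assumes expand: "\<And>d. \<bar>h (x + d) - h x - g \<bullet> d\<bar> \<le> C * (norm d)\<^sup>2"
  shows "grad h x = g"
proof -
  have "GDERIV h x :> g"
    unfolding gderiv_def has_derivative_at
  proof
    show "bounded_linear (\<lambda>d. d \<bullet> g)"
      by (rule bounded_linear_inner_left)
    have lim: "(\<lambda>d::'a. C * norm d) \<midarrow>0\<rightarrow> 0"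
      by (rule tendsto_eq_intros refl)+ simp
    show "(\<lambda>d. norm (h (x + d) - h x - d \<bullet> g) / norm d) \<midarrow>0\<rightarrow> 0"
    proof (rule Lim_null_comparison[OF _ lim], rule eventually_at_filter[THEN iffD2], rule always_eventually, intro allI impI)
      fix d :: 'a assume "d \<noteq> 0"
      then show "norm (norm (h (x + d) - h x - d \<bullet> g) / norm d) \<le> C * norm d"
        using expand[of d] by (simp add: inner_commute[of d] divide_le_eq power2_eq_square mult.assoc)
    qed
  qed
  moreover have "d = g" if "GDERIV h x :> d" for d
  proof -
    have "(\<lambda>v. v \<bullet> d) = (\<lambda>v. v \<bullet> g)"
      using that \<open>GDERIV h x :> g\<close> unfolding gderiv_def by (rule has_derivative_unique)
    then show "d = g" by (metis vector_eq_ldot)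
  qed
  ultimately show ?thesis
    unfolding grad_def by (rule the_equality)
qed

lemma half_power2_norm_le:
  assumes "norm v \<le> a * b"
  shows "(norm v)\<^sup>2 / 2 \<le> a\<^sup>2 / 2 * b\<^sup>2"
  using power_mono[OF assms norm_ge_zero, of 2] by (simp add: power_mult_distrib)

lemma grad_D_eq: "grad_D T D Y = (D ** Y - T) ** transpose Y"
  unfolding grad_D_def
proof (rule grad_eqI)
  fix H
  show "\<bar>fit T (D + H) Y - fit T D Y - ((D ** Y - T) ** transpose Y) \<bullet> H\<bar> \<le> (norm Y)\<^sup>2 / 2 * (norm H)\<^sup>2"
    using half_power2_norm_le[of "H ** Y" "norm Y" "norm H"] norm_matrix_mult_le[of H Y]
    by (simp add: fit_add_left mult.commute)
qed

lemma grad_X_eq: "grad_X T D Y = transpose D ** (D ** Y - T)"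
  unfolding grad_X_def
proof (rule grad_eqI)
  fix H
  show "\<bar>fit T D (Y + H) - fit T D Y - (transpose D ** (D ** Y - T)) \<bullet> H\<bar> \<le> (norm D)\<^sup>2 / 2 * (norm H)\<^sup>2"
    using half_power2_norm_le[of "D ** H" "norm D" "norm H"] norm_matrix_mult_le[of D H]
    by (simp add: fit_add_right)
qed

lemma fit_expand_D: "fit T (D + H) Y = fit T D Y + grad_D T D Y \<bullet> H + (norm (H ** Y))\<^sup>2 / 2"
  by (simp add: fit_add_left grad_D_eq)

lemma fit_expand_X: "fit T D (Y + H) = fit T D Y + grad_X T D Y \<bullet> H + (norm (D ** H))\<^sup>2 / 2"
  by (simp add: fit_add_right grad_X_eq)

lemma grad_D_diff: "grad_D T D Y - grad_D T D' Y = (D - D') ** Y ** transpose Y"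
  by (simp add: grad_D_eq matmul.diff_left)

lemma grad_X_diff: "grad_X T D Y - grad_X T D Y' = transpose D ** (D ** (Y - Y'))"
  by (simp add: grad_X_eq matmul.diff_right)

lemma grad_D_monotone: "0 \<le> (grad_D T D Y - grad_D T D' Y) \<bullet> (D - D')"
proof -
  have "(grad_D T D Y - grad_D T D' Y) \<bullet> (D - D') = ((D - D') ** Y) \<bullet> ((D - D') ** Y)"
    unfolding grad_D_diff by (metis inner_commute inner_matrix_mult_left)
  then show ?thesis by simp
qed

lemma grad_X_monotone: "0 \<le> (grad_X T D Y - grad_X T D Y') \<bullet> (Y - Y')"
proof -
  have "(grad_X T D Y - grad_X T D Y') \<bullet> (Y - Y') = (D ** (Y - Y')) \<bullet> (D ** (Y - Y'))"
    unfolding grad_X_diff by (metis inner_commute inner_matrix_mult_right)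
  then show ?thesis by simp
qed

lemma norm_residual_le:
  fixes D :: "real^'k^'m"
  assumes "norm D \<le> R" and "norm Y \<le> R"
  shows "norm (D ** Y - T) \<le> R\<^sup>2 + norm T"
proof -
  have "norm (D ** Y) \<le> R * R"
    using norm_matrix_mult_le[of D Y] mult_mono[OF assms] assms norm_ge_zero order_trans
    by (metis norm_ge_zero)
  then show ?thesis
    using norm_triangle_ineq4[of "D ** Y" T] by (simp add: power2_eq_square)
qed

text \<open>
  A Lipschitz constant, valid on the ball of radius \<open>R\<close>, of \<open>grad_D T\<close>, and of \<open>grad_X T\<close> in its
  dictionary argument.  The gradients are cubic polynomials, so it has to grow with \<open>R\<close>.
\<close>

definition grad_lipschitz :: "real \<Rightarrow> real^'n^'m \<Rightarrow> real" where
  "grad_lipschitz R T = 2 * R\<^sup>2 + norm T"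

lemma grad_lipschitz_nonneg: "0 \<le> grad_lipschitz R T"
  by (simp add: grad_lipschitz_def)

lemma grad_D_lipschitz:
  assumes "norm D \<le> R" and "norm D' \<le> R" and "norm Y \<le> R" and "norm Y' \<le> R"
  shows "norm (grad_D T D Y - grad_D T D' Y') \<le> grad_lipschitz R T * (norm (D - D') + norm (Y - Y'))"
proof -
  have R: "0 \<le> R" using assms(1) norm_ge_zero order_trans by blast
  have "norm (D ** Y - D' ** Y') \<le> R * norm (Y - Y') + R * norm (D - D')"
    by (rule norm_matrix_mult_diff_le) (use assms in auto)
  then have inner: "R * norm ((D ** Y - T) - (D' ** Y' - T)) \<le> R * (R * norm (Y - Y') + R * norm (D - D'))"
    using R by (simp add: mult_left_mono)
  have "norm (grad_D T D Y - grad_D T D' Y')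
      \<le> (R\<^sup>2 + norm T) * norm (transpose Y - transpose Y') + R * norm ((D ** Y - T) - (D' ** Y' - T))"
    unfolding grad_D_eq
    by (rule norm_matrix_mult_diff_le) (use assms norm_residual_le in \<open>auto simp: norm_transpose\<close>)
  also have "norm (transpose Y - transpose Y') = norm (Y - Y')"
    by (metis norm_transpose transpose_diff)
  finally have "norm (grad_D T D Y - grad_D T D' Y')
      \<le> (R\<^sup>2 + norm T) * norm (Y - Y') + R * (R * norm (Y - Y') + R * norm (D - D'))"
    using inner by linarith
  also have "\<dots> \<le> grad_lipschitz R T * (norm (D - D') + norm (Y - Y'))"
  proof -
    have "0 \<le> (R\<^sup>2 + norm T) * norm (D - D')" by simp
    then show ?thesis
      by (simp add: grad_lipschitz_def power2_eq_square algebra_simps)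
  qed
  finally show ?thesis .
qed

lemma norm_grad_D_le:
  assumes "norm D \<le> R" and "norm Y \<le> R"
  shows "norm (grad_D T D Y) \<le> (R\<^sup>2 + norm T) * R"
proof -
  have "norm (grad_D T D Y) \<le> norm (D ** Y - T) * norm Y"
    unfolding grad_D_eq using norm_matrix_mult_le[of "D ** Y - T" "transpose Y"]
    by (simp add: norm_transpose)
  also have "\<dots> \<le> (R\<^sup>2 + norm T) * R"
    using norm_residual_le[OF assms] assms by (intro mult_mono) auto
  finally show ?thesis .
qed

lemma grad_X_lipschitz:
  assumes "norm D \<le> R" and "norm D' \<le> R" and "norm Y \<le> R"
  shows "norm (grad_X T D Y - grad_X T D' Y) \<le> grad_lipschitz R T * norm (D - D')"
proof -
  have R: "0 \<le> R" using assms(1) norm_ge_zero order_trans by blast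
  have "norm (D ** Y - D' ** Y) \<le> R * norm (Y - Y) + R * norm (D - D')"
    by (rule norm_matrix_mult_diff_le) (use assms in auto)
  then have inner: "R * norm ((D ** Y - T) - (D' ** Y - T)) \<le> R * (R * norm (D - D'))"
    using R by (simp add: mult_left_mono)
  have "norm (grad_X T D Y - grad_X T D' Y)
      \<le> R * norm ((D ** Y - T) - (D' ** Y - T)) + (R\<^sup>2 + norm T) * norm (transpose D - transpose D')"
    unfolding grad_X_eq
    by (rule norm_matrix_mult_diff_le) (use assms norm_residual_le in \<open>auto simp: norm_transpose\<close>)
  also have "norm (transpose D - transpose D') = norm (D - D')"
    by (metis norm_transpose transpose_diff)
  finally have "norm (grad_X T D Y - grad_X T D' Y)
      \<le> R * (R * norm (D - D')) + (R\<^sup>2 + norm T) * norm (D - D')"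
    using inner by linarith
  also have "\<dots> = grad_lipschitz R T * norm (D - D')"
    by (simp add: grad_lipschitz_def power2_eq_square algebra_simps)
  finally show ?thesis .
qed

section \<open>Variational inequalities of the two subproblems\<close>

text \<open>
  Along the ray from the minimizer \<open>y\<close> to \<open>z\<close> the objective does not decrease.  Dividing by the ray
  parameter \<open>t\<close> and letting \<open>t\<close> tend to 0 removes the quadratic remainder.
\<close>

lemma arg_min_variational:
  fixes q h :: "'a::real_inner \<Rightarrow> real"
  assumes arg_min: "is_arg_min (\<lambda>y. q y + h y) (\<lambda>y. y \<in> C) y"
    and "convex C" and h: "convex_on C h"
    and expand: "\<And>d. q (y + d) \<le> q y + G \<bullet> d + K * (norm d)\<^sup>2"
    and z: "z \<in> C"
  shows "0 \<le> G \<bullet> (z - y) + h z - h y"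
proof -
  let ?A = "G \<bullet> (z - y) + h z - h y" and ?B = "K * (norm (z - y))\<^sup>2"
  have y: "y \<in> C" and min: "\<And>x. x \<in> C \<Longrightarrow> q y + h y \<le> q x + h x"
    using arg_min by (auto simp: is_arg_min_def not_less)
  have ray: "0 \<le> ?A + t * ?B" if t: "0 < t" "t \<le> 1" for t
  proof -
    have eq: "y + t *\<^sub>R (z - y) = (1 - t) *\<^sub>R y + t *\<^sub>R z"
      by (simp add: algebra_simps)
    have "y + t *\<^sub>R (z - y) \<in> C"
      unfolding eq using convexD_alt[OF \<open>convex C\<close> y z] t by simp
    then have "q y + h y \<le> q (y + t *\<^sub>R (z - y)) + h (y + t *\<^sub>R (z - y))"
      by (rule min)
    also have "h (y + t *\<^sub>R (z - y)) \<le> (1 - t) * h y + t * h z"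
      unfolding eq using convex_onD[OF h _ _ y z, of t] t by simp
    also have "q (y + t *\<^sub>R (z - y)) \<le> q y + t * (G \<bullet> (z - y)) + t * (t * ?B)"
      using expand[of "t *\<^sub>R (z - y)"] t by (simp add: power_mult_distrib power2_eq_square mult_ac)
    finally have "0 \<le> t * (?A + t * ?B)"
      by (simp add: algebra_simps)
    then show ?thesis using t by (simp add: zero_le_mult_iff)
  qed
  show ?thesis
  proof (rule tendsto_lowerbound)
    show "((\<lambda>t. ?A + t * ?B) \<longlongrightarrow> ?A) (at_right 0)"
      by (rule tendsto_eq_intros refl)+ simp
    show "eventually (\<lambda>t. 0 \<le> ?A + t * ?B) (at_right 0)"
      using ray by (auto simp: eventually_at_right_field intro!: exI[of _ 1])
  qed simp
qed

lemma convex_on_norm11: "convex_on UNIV (norm11 :: real^'b^'a \<Rightarrow> real)"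
proof (intro convex_onI)
  fix t :: real and A B :: "real^'b^'a"
  assume t: "0 < t" "t < 1"
  have "norm11 ((1 - t) *\<^sub>R A + t *\<^sub>R B)
      \<le> (\<Sum>i\<in>UNIV. \<Sum>j\<in>UNIV. (1 - t) * \<bar>A $ i $ j\<bar> + t * \<bar>B $ i $ j\<bar>)"
    unfolding norm11_def
  proof (intro sum_mono)
    fix i j
    show "\<bar>((1 - t) *\<^sub>R A + t *\<^sub>R B) $ i $ j\<bar> \<le> (1 - t) * \<bar>A $ i $ j\<bar> + t * \<bar>B $ i $ j\<bar>"
      using abs_triangle_ineq[of "(1 - t) * A $ i $ j" "t * B $ i $ j"] t by (simp add: abs_mult)
  qed
  then show "norm11 ((1 - t) *\<^sub>R A + t *\<^sub>R B) \<le> (1 - t) * norm11 A + t * norm11 B"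
    by (simp add: norm11_def sum.distrib sum_distrib_left)
qed simp

lemma norm11_nonneg: "0 \<le> norm11 A"
  by (simp add: norm11_def sum_nonneg)

lemma subspace_block_space: "subspace (block_space blk i :: (real^'n^'a) set)"
  by (auto simp: subspace_def block_space_def)

text \<open>
  With \<open>\<tau> = 0\<close> this also covers the problem that defines the optimal code.
\<close>

lemma code_variational:
  fixes Y X :: "real^'n^'k"
  assumes arg_min: "is_arg_min
      (\<lambda>Y. fit T D Y + \<tau> / 2 * (norm (Y - X))\<^sup>2 + lam * norm11 Y + \<mu> * (norm Y)\<^sup>2) (\<lambda>Y. Y \<in> C) Y"
    and C: "convex C" and lam: "0 \<le> lam" and Z: "Z \<in> C"
  shows "0 \<le> (grad_X T D Y + \<tau> *\<^sub>R (Y - X) + (2 * \<mu>) *\<^sub>R Y) \<bullet> (Z - Y)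
    + lam * norm11 Z - lam * norm11 Y"
proof (rule arg_min_variational[OF _ C _ _ Z])
  let ?q = "\<lambda>Y. fit T D Y + \<tau> / 2 * (norm (Y - X))\<^sup>2 + \<mu> * (norm Y)\<^sup>2"
  show "is_arg_min (\<lambda>Y. ?q Y + lam * norm11 Y) (\<lambda>Y. Y \<in> C) Y"
    using arg_min by (simp add: algebra_simps)
  show "convex_on C (\<lambda>Y. lam * norm11 Y)"
    using convex_on_cmul[OF lam convex_on_norm11] C convex_on_subset by blast
  fix H
  have "Y + H - X = (Y - X) + H" by simp
  then have sq: "(norm (Y + H - X))\<^sup>2 = (norm (Y - X))\<^sup>2 + 2 * ((Y - X) \<bullet> H) + (norm H)\<^sup>2"
    by (simp only: power2_norm_add)
  have "(norm (D ** H))\<^sup>2 / 2 \<le> (norm D)\<^sup>2 / 2 * (norm H)\<^sup>2"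
    by (rule half_power2_norm_le) (rule norm_matrix_mult_le)
  then show "?q (Y + H) \<le> ?q Y + (grad_X T D Y + \<tau> *\<^sub>R (Y - X) + (2 * \<mu>) *\<^sub>R Y) \<bullet> H
      + ((norm D)\<^sup>2 / 2 + \<tau> / 2 + \<mu>) * (norm H)\<^sup>2"
    unfolding fit_expand_X sq power2_norm_add by (simp add: inner_add_left algebra_simps)
qed

lemma dict_variational:
  fixes Dt D :: "real^'k^'m"
  assumes arg_min: "is_arg_min
      (\<lambda>D'. fit T D' Y + \<tau> / 2 * (norm (D' - D))\<^sup>2 + P \<bullet> (D' - D)) (\<lambda>D'. D' \<in> C) Dt"
    and C: "convex C" and Z: "Z \<in> C"
  shows "0 \<le> (grad_D T Dt Y + \<tau> *\<^sub>R (Dt - D) + P) \<bullet> (Z - Dt)"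
proof -
  let ?q = "\<lambda>D'. fit T D' Y + \<tau> / 2 * (norm (D' - D))\<^sup>2 + P \<bullet> (D' - D)"
  have "0 \<le> (grad_D T Dt Y + \<tau> *\<^sub>R (Dt - D) + P) \<bullet> (Z - Dt) + 0 - 0"
  proof (rule arg_min_variational[OF _ C _ _ Z])
    show "is_arg_min (\<lambda>D'. ?q D' + 0) (\<lambda>D'. D' \<in> C) Dt"
      using arg_min by simp
    show "convex_on C (\<lambda>_. 0)"
      by (simp add: convex_on_const C)
    fix H
    have eq: "Dt + H - D = (Dt - D) + H" by simp
    have "(norm (H ** Y))\<^sup>2 / 2 \<le> (norm Y)\<^sup>2 / 2 * (norm H)\<^sup>2"
      by (rule half_power2_norm_le) (metis norm_matrix_mult_le mult.commute)
    then show "?q (Dt + H) \<le> ?q Dt + (grad_D T Dt Y + \<tau> *\<^sub>R (Dt - D) + P) \<bullet> H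
        + ((norm Y)\<^sup>2 / 2 + \<tau> / 2) * (norm H)\<^sup>2"
      unfolding fit_expand_D eq power2_norm_add by (simp add: inner_add_left inner_add_right algebra_simps)
  qed
  then show ?thesis by simp
qed

lemma convex_dict_set: "convex (dict_set \<alpha> :: (real^'k^'m) set)"
proof -
  have "(dict_set \<alpha> :: (real^'k^'m) set) = (\<Inter>k. (\<lambda>D. D *v axis k 1) -` cball 0 \<alpha>)"
    by (auto simp: dict_set_def)
  moreover have "linear (\<lambda>D :: real^'k^'m. D *v axis k 1)" for k
    by (intro linearI) (simp_all add: matrix_vector_mult_add_rdistrib scaleR_matrix_vector_assoc)
  ultimately show ?thesis
    by (simp add: convex_INT convex_linear_vimage)
qed

lemma closed_dict_set: "closed (dict_set \<alpha> :: (real^'k^'m) set)"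
proof -
  have "(dict_set \<alpha> :: (real^'k^'m) set) = (\<Inter>k. (\<lambda>D. D *v axis k 1) -` cball 0 \<alpha>)"
    by (auto simp: dict_set_def)
  moreover have "linear (\<lambda>D :: real^'k^'m. D *v axis k 1)" for k
    by (intro linearI) (simp_all add: matrix_vector_mult_add_rdistrib scaleR_matrix_vector_assoc)
  ultimately show ?thesis
    by (auto intro!: closed_INT continuous_closed_vimage linear_continuous_at
        simp: linear_conv_bounded_linear)
qed

lemma bounded_dict_set: "bounded (dict_set \<alpha> :: (real^'k^'m) set)"
proof (rule boundedI)
  fix D :: "real^'k^'m"
  assume D: "D \<in> dict_set \<alpha>"
  have entry: "\<bar>D $ i $ k\<bar> \<le> \<alpha>" for i k
  proof -
    have "D $ i $ k = (D *v axis k 1) $ i"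
      by (simp add: matrix_vector_mult_basis column_def)
    also have "\<bar>\<dots>\<bar> \<le> norm (D *v axis k 1)"
      by (rule component_le_norm_cart)
    also have "\<dots> \<le> \<alpha>" using D by (simp add: dict_set_def)
    finally show ?thesis .
  qed
  have "norm (D $ i) \<le> (\<Sum>k\<in>(UNIV::'k set). \<alpha>)" for i
    by (rule order_trans[OF norm_le_l1_cart]) (intro sum_mono entry)
  then show "norm D \<le> (\<Sum>i\<in>(UNIV::'m set). \<Sum>k\<in>(UNIV::'k set). \<alpha>)"
    unfolding norm_vec_def[of D] by (intro order_trans[OF L2_set_le_sum] sum_mono) auto
qed

section \<open>Optimal codes of a dictionary\<close>

definition opt_code :: "real \<Rightarrow> real \<Rightarrow> (real^'n^'k) set \<Rightarrow> real^'n^'m \<Rightarrow> real^'k^'m \<Rightarrow> real^'n^'k" where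
  "opt_code lam \<mu> C T D = (SOME Y. is_arg_min (\<lambda>Y. fit T D Y + reg lam \<mu> Y) (\<lambda>Y. Y \<in> C) Y)"

text \<open>
  For a fixed dictionary the codes solve an elastic-net problem, whose objective is \<open>2 \<mu>\<close>-strongly
  convex.  Its solution map \<open>xhat\<close> makes it possible to eliminate the codes from the analysis.
\<close>

locale elastic_net =
  fixes lam \<mu> :: real and C :: "(real^'n^'k) set" and T :: "real^'n^'m"
  assumes lam: "0 \<le> lam" and \<mu>: "0 < \<mu>"
    and C: "subspace C"
begin

lemma convex_C: "convex C"
  using C by (rule subspace_imp_convex)

abbreviation xhat :: "real^'k^'m \<Rightarrow> real^'n^'k" where
  "xhat \<equiv> opt_code lam \<mu> C T"

abbreviation obj :: "real^'k^'m \<Rightarrow> real^'n^'k \<Rightarrow> real" where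
  "obj D Y \<equiv> fit T D Y + reg lam \<mu> Y"

lemma obj_lower: "\<mu> * (norm Y)\<^sup>2 \<le> obj D Y"
  using lam by (simp add: fit_def reg_def norm11_nonneg)

lemma obj_zero: "obj D 0 = (norm T)\<^sup>2 / 2"
  by (simp add: fit_def reg_def norm11_def matmul.zero_right)

lemma continuous_obj: "continuous_on A (obj D)"
  unfolding fit_def reg_def norm11_def
  by (intro continuous_intros matmul.continuous_on)

lemma xhat_arg_min: "is_arg_min (obj D) (\<lambda>Y. Y \<in> C) (xhat D)"
proof -
  \<comment> \<open>Outside this ball \<open>\<mu> (norm Y)\<^sup>2\<close>, a lower bound of the objective, exceeds the objective at 0.\<close>
  define R where "R = sqrt (obj D 0 / \<mu>)"
  have "compact (C \<inter> cball 0 R)"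
    using closed_subspace[OF C] by (simp add: closed_Int_compact)
  moreover have "0 \<in> C \<inter> cball 0 R"
    using \<mu> subspace_0[OF C] by (simp add: R_def obj_zero)
  ultimately obtain Y where Y: "Y \<in> C" and min: "\<And>Z. Z \<in> C \<Longrightarrow> norm Z \<le> R \<Longrightarrow> obj D Y \<le> obj D Z"
    using continuous_attains_inf[OF _ _ continuous_obj, of "C \<inter> cball 0 R" D]
    by (metis IntE IntI empty_iff mem_cball_0)
  have "obj D Y \<le> obj D Z" if "Z \<in> C" for Z
  proof (cases "norm Z \<le> R")
    case True
    with that show ?thesis by (rule min)
  next
    case False
    then have "\<not> obj D 0 / \<mu> \<ge> (norm Z)\<^sup>2"
      unfolding R_def using real_le_rsqrt by blast
    then have "obj D 0 \<le> obj D Z"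
      using obj_lower[of Z D] \<mu> by (simp add: field_simps)
    moreover have "obj D Y \<le> obj D 0"
      using \<mu> subspace_0[OF C] by (intro min) (simp_all add: R_def obj_zero)
    ultimately show ?thesis by linarith
  qed
  then have "is_arg_min (obj D) (\<lambda>Y. Y \<in> C) Y"
    using Y by (auto simp: is_arg_min_def not_less)
  then show ?thesis
    unfolding opt_code_def by (rule someI)
qed

lemma xhat_in: "xhat D \<in> C"
  using xhat_arg_min by (simp add: is_arg_min_def)

lemma xhat_minimal: "Y \<in> C \<Longrightarrow> obj D (xhat D) \<le> obj D Y"
  using xhat_arg_min by (auto simp: is_arg_min_def not_less)

definition code_bound :: real where
  "code_bound = sqrt ((norm T)\<^sup>2 / (2 * \<mu>))"

lemma norm_xhat_le: "norm (xhat D) \<le> code_bound"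
proof -
  have "\<mu> * (norm (xhat D))\<^sup>2 \<le> (norm T)\<^sup>2 / 2"
    using obj_lower[of "xhat D" D] xhat_minimal[of 0 D] subspace_0[OF C] obj_zero[of D] by linarith
  then show ?thesis
    unfolding code_bound_def using \<mu> by (intro real_le_rsqrt) (simp add: field_simps)
qed

lemma xhat_variational:
  assumes "Z \<in> C"
  shows "0 \<le> (grad_X T D (xhat D) + (2 * \<mu>) *\<^sub>R xhat D) \<bullet> (Z - xhat D)
    + lam * norm11 Z - lam * norm11 (xhat D)"
  using code_variational[of T D 0 0 lam \<mu> C "xhat D" Z] xhat_arg_min[of D] convex_C lam assms
  by (simp add: reg_def algebra_simps)

lemma xhat_stationary:
  assumes "Z \<in> C"
  shows "0 \<le> grad_X T D (xhat D) \<bullet> (Z - xhat D) + reg lam \<mu> Z - reg lam \<mu> (xhat D)"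
proof -
  have "(norm Z)\<^sup>2 = (norm (xhat D))\<^sup>2 + 2 * (xhat D \<bullet> (Z - xhat D)) + (norm (Z - xhat D))\<^sup>2"
    using power2_norm_add[of "xhat D" "Z - xhat D"] by simp
  then have "2 * (xhat D \<bullet> (Z - xhat D)) \<le> (norm Z)\<^sup>2 - (norm (xhat D))\<^sup>2"
    by simp
  from mult_left_mono[OF this, of \<mu>] \<mu>
  have "(2 * \<mu>) * (xhat D \<bullet> (Z - xhat D)) \<le> \<mu> * (norm Z)\<^sup>2 - \<mu> * (norm (xhat D))\<^sup>2"
    by (simp add: algebra_simps)
  then show ?thesis
    using xhat_variational[OF assms, of D] by (simp add: reg_def inner_add_left)
qed

text \<open>
  Test the variational inequality of each of the two codes with the other code and add: the
  \<open>norm11\<close> terms cancel, and strong convexity bounds the distance of the codes by the change of the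
  gradient.
\<close>

lemma xhat_lipschitz:
  assumes "norm D \<le> R" and "norm D' \<le> R" and "code_bound \<le> R"
  shows "norm (xhat D - xhat D') \<le> grad_lipschitz R T / (2 * \<mu>) * norm (D - D')"
proof -
  let ?x = "xhat D" and ?x' = "xhat D'"
  have "0 \<le> (grad_X T D ?x + (2 * \<mu>) *\<^sub>R ?x) \<bullet> (?x' - ?x) + lam * norm11 ?x' - lam * norm11 ?x"
    by (rule xhat_variational) (rule xhat_in)
  moreover have "0 \<le> (grad_X T D' ?x' + (2 * \<mu>) *\<^sub>R ?x') \<bullet> (?x - ?x') + lam * norm11 ?x - lam * norm11 ?x'"
    by (rule xhat_variational) (rule xhat_in)
  moreover have "0 \<le> (grad_X T D' ?x - grad_X T D' ?x') \<bullet> (?x - ?x')"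
    by (rule grad_X_monotone)
  ultimately have "2 * \<mu> * ((?x - ?x') \<bullet> (?x - ?x')) \<le> (grad_X T D' ?x - grad_X T D ?x) \<bullet> (?x - ?x')"
    by (simp add: algebra_simps inner_commute)
  also have "\<dots> \<le> norm (grad_X T D' ?x - grad_X T D ?x) * norm (?x - ?x')"
    by (rule norm_cauchy_schwarz)
  also have "\<dots> \<le> (grad_lipschitz R T * norm (D - D')) * norm (?x - ?x')"
    using grad_X_lipschitz[of D' R D ?x T] assms norm_xhat_le[of D]
    by (intro mult_right_mono) (auto simp: norm_minus_commute)
  finally have le: "2 * \<mu> * norm (?x - ?x') * norm (?x - ?x')
      \<le> (grad_lipschitz R T * norm (D - D')) * norm (?x - ?x')"
    by (simp add: dot_square_norm power2_eq_square mult.assoc)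
  have "2 * \<mu> * norm (?x - ?x') \<le> grad_lipschitz R T * norm (D - D')"
  proof (cases "?x = ?x'")
    case True
    then show ?thesis by (simp add: grad_lipschitz_nonneg)
  next
    case False
    then show ?thesis using le by (simp only: mult_le_cancel_right) simp
  qed
  then show ?thesis using \<mu> by (simp add: field_simps)
qed

text \<open>
  The proximal step for the codes has \<open>xhat D\<close> as its fixed point, and strong convexity makes it a
  contraction.  Hence the codes follow the dictionaries, with an error controlled by the speed of the
  dictionaries.
\<close>

lemma prox_step_contracts:
  assumes arg_min: "is_arg_min
      (\<lambda>Y. fit T D Y + \<tau> / 2 * (norm (Y - X))\<^sup>2 + lam * norm11 Y + \<mu> * (norm Y)\<^sup>2) (\<lambda>Y. Y \<in> C) Y"
    and \<tau>: "0 \<le> \<tau>" "\<tau> \<le> c"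
  shows "norm (Y - xhat D) \<le> c / (2 * \<mu> + c) * norm (X - xhat D)"
proof -
  let ?x = "xhat D"
  have Y: "Y \<in> C" using arg_min by (simp add: is_arg_min_def)
  have "0 \<le> (grad_X T D ?x + (2 * \<mu>) *\<^sub>R ?x) \<bullet> (Y - ?x) + lam * norm11 Y - lam * norm11 ?x"
    by (rule xhat_variational[OF Y])
  moreover have "0 \<le> (grad_X T D Y + \<tau> *\<^sub>R (Y - X) + (2 * \<mu>) *\<^sub>R Y) \<bullet> (?x - Y)
      + lam * norm11 ?x - lam * norm11 Y"
    by (rule code_variational[OF arg_min convex_C lam xhat_in])
  moreover have "0 \<le> (grad_X T D Y - grad_X T D ?x) \<bullet> (Y - ?x)"
    by (rule grad_X_monotone)
  ultimately have "(2 * \<mu> + \<tau>) * ((Y - ?x) \<bullet> (Y - ?x)) \<le> \<tau> * ((X - ?x) \<bullet> (Y - ?x))"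
    by (simp add: algebra_simps inner_commute)
  also have "\<dots> \<le> \<tau> * (norm (X - ?x) * norm (Y - ?x))"
    using \<tau> by (intro mult_left_mono norm_cauchy_schwarz)
  finally have le: "((2 * \<mu> + \<tau>) * norm (Y - ?x)) * norm (Y - ?x) \<le> (\<tau> * norm (X - ?x)) * norm (Y - ?x)"
    by (simp add: dot_square_norm power2_eq_square mult.assoc)
  have "(2 * \<mu> + \<tau>) * norm (Y - ?x) \<le> \<tau> * norm (X - ?x)"
  proof (cases "Y = ?x")
    case True
    then show ?thesis using \<tau> by simp
  next
    case False
    then show ?thesis using le by (simp only: mult_le_cancel_right) simp
  qed
  then have "norm (Y - ?x) \<le> \<tau> / (2 * \<mu> + \<tau>) * norm (X - ?x)"
    using \<mu> \<tau> by (simp add: field_simps)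
  also have "\<dots> \<le> c / (2 * \<mu> + c) * norm (X - ?x)"
    using \<mu> \<tau> by (intro mult_right_mono) (simp_all add: field_simps)
  finally show ?thesis .
qed

end

section \<open>Boundedness of a run\<close>

text \<open>
  A run of the algorithm in which the initial dictionaries need not be feasible, every step size is
  at most 1, and initially the trackers \<open>\<Theta>\<close> sum to the sum of the local gradients.  The algorithm
  satisfies this from its second iterate on.
\<close>

locale d2l = mixing_weights W E \<theta> B
  for W :: "nat \<Rightarrow> real^'i^'i" and E :: "nat \<Rightarrow> ('i \<times> 'i) set" and \<theta> :: real and B :: nat +
  fixes lam \<mu> :: real and C :: "'i \<Rightarrow> (real^'n^'k) set" and T :: "'i \<Rightarrow> real^'n^'m"
    and \<D> :: "(real^'k^'m) set"
    and \<gamma> :: "nat \<Rightarrow> real" and \<tau>D \<tau>X :: "nat \<Rightarrow> 'i \<Rightarrow> real" and \<tau>min \<tau>max :: real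
    and D Dt U \<Theta> :: "nat \<Rightarrow> 'i \<Rightarrow> real^'k^'m" and X :: "nat \<Rightarrow> 'i \<Rightarrow> real^'n^'k"
  assumes lam: "0 \<le> lam" and \<mu>: "0 < \<mu>" and C: "subspace (C i)"
    and \<D>: "convex \<D>" "closed \<D>" "bounded \<D>"
    and \<gamma>_nonneg: "0 \<le> \<gamma> \<nu>" and \<gamma>_le_1: "\<gamma> \<nu> \<le> 1"
    and \<gamma>_diverges: "\<not> summable \<gamma>" and \<gamma>_square: "square_summable \<gamma>"
    and \<tau>D: "0 < \<tau>min" "\<tau>min \<le> \<tau>D \<nu> i" "\<tau>D \<nu> i \<le> \<tau>max"
    and \<tau>X: "0 \<le> \<tau>X \<nu> i" "\<tau>X \<nu> i \<le> \<tau>max"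
    and Dt: "is_arg_min
        (\<lambda>D'. fit (T i) D' (X \<nu> i) + \<tau>D \<nu> i / 2 * (norm (D' - D \<nu> i))\<^sup>2
          + (of_nat CARD('i) *\<^sub>R \<Theta> \<nu> i - grad_D (T i) (D \<nu> i) (X \<nu> i)) \<bullet> (D' - D \<nu> i))
        (\<lambda>D'. D' \<in> \<D>) (Dt \<nu> i)"
    and U: "U \<nu> i = D \<nu> i + \<gamma> \<nu> *\<^sub>R (Dt \<nu> i - D \<nu> i)"
    and X_step: "is_arg_min
        (\<lambda>Y. fit (T i) (U \<nu> i) Y + \<tau>X \<nu> i / 2 * (norm (Y - X \<nu> i))\<^sup>2 + lam * norm11 Y + \<mu> * (norm Y)\<^sup>2)
        (\<lambda>Y. Y \<in> C i) (X (Suc \<nu>) i)"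
    and D_step: "D (Suc \<nu>) i = (\<Sum>j\<in>UNIV. W \<nu> $ i $ j *\<^sub>R U \<nu> j)"
    and \<Theta>_step: "\<Theta> (Suc \<nu>) i = (\<Sum>j\<in>UNIV. W \<nu> $ i $ j *\<^sub>R \<Theta> \<nu> j)
        + (grad_D (T i) (D (Suc \<nu>) i) (X (Suc \<nu>) i) - grad_D (T i) (D \<nu> i) (X \<nu> i))"
    and \<Theta>_start: "(\<Sum>i\<in>UNIV. \<Theta> 0 i) = (\<Sum>i\<in>UNIV. grad_D (T i) (D 0 i) (X 0 i))"
begin

sublocale en: elastic_net lam \<mu> "C i" "T i" for i
  by unfold_locales (rule lam \<mu> C)+

abbreviation xh :: "'i \<Rightarrow> real^'k^'m \<Rightarrow> real^'n^'k" where
  "xh i \<equiv> opt_code lam \<mu> (C i) (T i)"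

lemma Dt_in: "Dt \<nu> i \<in> \<D>"
  using Dt by (simp add: is_arg_min_def)

text \<open>
  The unit of the distance between the dictionaries and the set \<open>\<D>\<close>: a step with step size
  \<open>\<gamma> \<nu>\<close> towards a point of \<open>\<D>\<close> multiplies this distance by at most \<open>1 - \<gamma> \<nu>\<close>.
\<close>

definition infeasibility :: "nat \<Rightarrow> real" where
  "infeasibility \<nu> = (\<Prod>s<\<nu>. 1 - \<gamma> s)"

lemma infeasibility_Suc: "infeasibility (Suc \<nu>) = (1 - \<gamma> \<nu>) * infeasibility \<nu>"
  by (simp add: infeasibility_def)

lemma infeasibility_nonneg: "0 \<le> infeasibility \<nu>"
  by (simp add: infeasibility_def prod_nonneg \<gamma>_le_1)

lemma infeasibility_le_1: "infeasibility \<nu> \<le> 1"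
  by (simp add: infeasibility_def prod_le_1 \<gamma>_nonneg \<gamma>_le_1)

text \<open>
  The product telescopes: \<open>\<gamma> \<nu>\<close> times its value is its decrease in step \<open>\<nu>\<close>.
\<close>

lemma summable_infeasibility: "summable (\<lambda>\<nu>. \<gamma> \<nu> * infeasibility \<nu>)"
proof (rule summable_of_decrease[of _ infeasibility "\<lambda>_. 0"])
  show "\<gamma> \<nu> * infeasibility \<nu> \<le> infeasibility \<nu> - infeasibility (Suc \<nu>) + 0" for \<nu>
    by (simp add: infeasibility_Suc algebra_simps)
qed (simp_all add: infeasibility_nonneg \<gamma>_nonneg)

lemma infeasibility_tendsto_zero: "infeasibility \<longlonglongrightarrow> 0"
proof -
  have dec: "decseq infeasibility"
    by (rule decseq_SucI)
      (simp add: infeasibility_Suc mult_left_le_one_le infeasibility_nonneg \<gamma>_nonneg \<gamma>_le_1)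
  obtain l where l: "infeasibility \<longlonglongrightarrow> l" and lower: "\<And>\<nu>. l \<le> infeasibility \<nu>"
    using decseq_convergent[OF dec, of 0] infeasibility_nonneg by blast
  have "l \<le> 0"
  proof (rule ccontr)
    assume "\<not> l \<le> 0"
    have "summable (\<lambda>\<nu>. l * \<gamma> \<nu>)"
    proof (rule summable_comparison_test)
      show "\<exists>N. \<forall>\<nu>\<ge>N. norm (l * \<gamma> \<nu>) \<le> \<gamma> \<nu> * infeasibility \<nu>"
        using \<open>\<not> l \<le> 0\<close> mult_right_mono[OF lower \<gamma>_nonneg] by (simp add: abs_mult \<gamma>_nonneg mult.commute)
    qed (rule summable_infeasibility)
    then show False
      using \<gamma>_diverges \<open>\<not> l \<le> 0\<close> by (simp add: summable_cmult_iff)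
  qed
  moreover have "0 \<le> l"
    using LIMSEQ_le_const[OF l] infeasibility_nonneg by blast
  ultimately show ?thesis using l by simp
qed

text \<open>
  Apply the algorithm to feasible companions \<open>c\<close> of the dictionaries, with the same minimizers
  \<open>Dt\<close>.  The companions stay feasible, since \<open>\<D>\<close> is convex, and both steps are affine, so the
  differences contract.
\<close>

lemma near_feasible: "\<exists>K\<ge>0. \<forall>\<nu> i. \<exists>c\<in>\<D>. norm (D \<nu> i - c) \<le> K * infeasibility \<nu>"
proof -
  obtain c0 where c0: "c0 \<in> \<D>" using Dt_in by blast
  define K where "K = (\<Sum>i\<in>UNIV. norm (D 0 i - c0))"
  have "\<exists>c\<in>\<D>. norm (D \<nu> i - c) \<le> K * infeasibility \<nu>" for \<nu> i
  proof (induction \<nu> arbitrary: i)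
    case 0
    have "norm (D 0 i - c0) \<le> K"
      unfolding K_def by (rule member_le_sum) auto
    then show ?case using c0 by (auto simp: infeasibility_def)
  next
    case (Suc \<nu>)
    then obtain c where c: "\<And>j. c j \<in> \<D>" and le: "\<And>j. norm (D \<nu> j - c j) \<le> K * infeasibility \<nu>"
      by metis
    let ?c = "\<Sum>j\<in>UNIV. W \<nu> $ i $ j *\<^sub>R ((1 - \<gamma> \<nu>) *\<^sub>R c j + \<gamma> \<nu> *\<^sub>R Dt \<nu> j)"
    have "?c \<in> \<D>"
      by (rule convex_sum)
        (auto simp: W_nonneg W_rows \<D> \<gamma>_nonneg \<gamma>_le_1 c Dt_in intro!: convexD_alt)
    moreover have "D (Suc \<nu>) i - ?c = (\<Sum>j\<in>UNIV. W \<nu> $ i $ j *\<^sub>R ((1 - \<gamma> \<nu>) *\<^sub>R (D \<nu> j - c j)))"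
      unfolding D_step U sum_subtractf[symmetric] scaleR_diff_right[symmetric]
      by (intro sum.cong refl arg_cong[where f = "scaleR _"]) (simp add: algebra_simps)
    moreover have "norm \<dots> \<le> (1 - \<gamma> \<nu>) * (K * infeasibility \<nu>)"
      by (rule norm_mix_le) (simp add: \<gamma>_le_1 le mult_left_mono)
    ultimately have "norm (D (Suc \<nu>) i - ?c) \<le> (1 - \<gamma> \<nu>) * (K * infeasibility \<nu>)" "?c \<in> \<D>"
      by (simp_all only:)
    then show ?case
      unfolding infeasibility_Suc mult.left_commute[of K] by blast
  qed
  moreover have "0 \<le> K" by (simp add: K_def sum_nonneg)
  ultimately show ?thesis by blast
qed

lemma D_bounded: "\<exists>K. \<forall>\<nu> i. norm (D \<nu> i) \<le> K"
proof -
  obtain K b where K: "0 \<le> K" "\<And>\<nu> i. \<exists>c\<in>\<D>. norm (D \<nu> i - c) \<le> K * infeasibility \<nu>"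
    and b: "\<And>c. c \<in> \<D> \<Longrightarrow> norm c \<le> b"
    using near_feasible \<D>(3) unfolding bounded_iff by metis
  have "norm (D \<nu> i) \<le> b + K" for \<nu> i
  proof -
    obtain c where c: "c \<in> \<D>" "norm (D \<nu> i - c) \<le> K * infeasibility \<nu>"
      using K(2) by blast
    have "K * infeasibility \<nu> \<le> K"
      using K(1) infeasibility_nonneg infeasibility_le_1 by (simp add: mult_left_le)
    then show ?thesis
      using c b[OF c(1)] norm_triangle_sub[of "D \<nu> i" c] by linarith
  qed
  then show ?thesis by blast
qed

definition code_rate :: real where
  "code_rate = \<tau>max / (2 * \<mu> + \<tau>max)"

lemma code_rate: "0 \<le> code_rate" "code_rate < 1"
  using \<mu> \<tau>X[of 0 undefined] by (simp_all add: code_rate_def)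

lemma code_step_contracts:
  "norm (X (Suc \<nu>) i - xh i (U \<nu> i)) \<le> code_rate * norm (X \<nu> i - xh i (U \<nu> i))"
  unfolding code_rate_def by (rule en.prox_step_contracts[OF X_step \<tau>X])

text \<open>
  The codes contract towards optimal codes, which are bounded uniformly in the dictionary.
\<close>

lemma X_bounded: "\<exists>K. \<forall>\<nu> i. norm (X \<nu> i) \<le> K"
proof -
  have "norm (X \<nu> i) \<le> max (norm (X 0 i)) (2 * en.code_bound i / (1 - code_rate))" (is "_ \<le> ?K i") for \<nu> i
  proof (induction \<nu>)
    case (Suc \<nu>)
    let ?x = "xh i (U \<nu> i)" and ?b = "en.code_bound i"
    have "norm (X (Suc \<nu>) i) \<le> norm ?x + norm (X (Suc \<nu>) i - ?x)"
      by (rule norm_triangle_sub)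
    also have "norm (X (Suc \<nu>) i - ?x) \<le> code_rate * (norm (X \<nu> i) + norm ?x)"
      by (rule order_trans[OF code_step_contracts])
        (intro mult_left_mono norm_triangle_ineq4 code_rate)
    also have "\<dots> \<le> code_rate * (?K i) + 1 * ?b"
      unfolding distrib_left using code_rate Suc en.norm_xhat_le[where i = i and D = "U \<nu> i"]
      by (intro add_mono mult_mono) auto
    also have "norm ?x \<le> ?b" by (rule en.norm_xhat_le)
    finally have "norm (X (Suc \<nu>) i) \<le> 2 * ?b + code_rate * (?K i)" by simp
    moreover have "2 * ?b \<le> (?K i) * (1 - code_rate)"
      using code_rate by (subst pos_divide_le_eq[symmetric]) (simp, rule max.cobounded2)
    ultimately show ?case
      unfolding right_diff_distrib mult_1_right mult.commute[of "?K i"] by linarith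
  qed simp
  then have "norm (X \<nu> i) \<le> (\<Sum>j\<in>UNIV. \<bar>?K j\<bar>)" for \<nu> i
    using member_le_sum[of i UNIV "\<lambda>j. \<bar>?K j\<bar>"] abs_ge_self[of "?K i"]
    by (smt (verit, best) UNIV_I abs_ge_zero finite)
  then show ?thesis by blast
qed

lemma ex_bound: "\<exists>R. (\<forall>\<nu> i. norm (D \<nu> i) \<le> R) \<and> (\<forall>\<nu> i. norm (X \<nu> i) \<le> R)
    \<and> (\<forall>c\<in>\<D>. norm c \<le> R) \<and> (\<forall>i. en.code_bound i \<le> R)"
proof -
  obtain K1 K2 K3 where K: "\<And>\<nu> i. norm (D \<nu> i) \<le> K1" "\<And>\<nu> i. norm (X \<nu> i) \<le> K2"
      "\<And>c. c \<in> \<D> \<Longrightarrow> norm c \<le> K3"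
    using D_bounded X_bounded \<D>(3) unfolding bounded_iff by metis
  let ?R = "max (max K1 K2) (max K3 (Max (range en.code_bound)))"
  show ?thesis
    by (rule exI[of _ ?R]) (auto simp: le_max_iff_disj K)
qed

text \<open>
  One radius for all iterates, so that the gradients are Lipschitz with fixed constants.
\<close>

definition R :: real where
  "R = (SOME R. (\<forall>\<nu> i. norm (D \<nu> i) \<le> R) \<and> (\<forall>\<nu> i. norm (X \<nu> i) \<le> R)
    \<and> (\<forall>c\<in>\<D>. norm c \<le> R) \<and> (\<forall>i. en.code_bound i \<le> R))"

lemma D_le: "norm (D \<nu> i) \<le> R" and X_le: "norm (X \<nu> i) \<le> R"
  and dict_le: "c \<in> \<D> \<Longrightarrow> norm c \<le> R" and code_le: "en.code_bound i \<le> R"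
  using someI_ex[OF ex_bound, folded R_def] by blast+

section \<open>Square-summable errors\<close>

lemma R_nonneg: "0 \<le> R"
  using D_le norm_ge_zero order_trans by blast

lemma Dt_le: "norm (Dt \<nu> i) \<le> R"
  by (rule dict_le) (rule Dt_in)

lemma xh_le: "norm (xh i A) \<le> R"
  using en.norm_xhat_le code_le order_trans by blast

definition avg :: "nat \<Rightarrow> real^'k^'m" where
  "avg \<nu> = average (D \<nu>)"

lemma avg_le: "norm (avg \<nu>) \<le> R"
  unfolding avg_def by (rule norm_average_le) (rule D_le)

lemma U_convex: "U \<nu> i = (1 - \<gamma> \<nu>) *\<^sub>R D \<nu> i + \<gamma> \<nu> *\<^sub>R Dt \<nu> i"
  by (simp add: U algebra_simps)

lemma U_le: "norm (U \<nu> i) \<le> R"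
  using convexD_alt[OF convex_cball[of 0 R], of "D \<nu> i" "Dt \<nu> i" "\<gamma> \<nu>"]
  by (simp add: U_convex D_le Dt_le \<gamma>_nonneg \<gamma>_le_1)

lemma dist_Dt_le: "norm (Dt \<nu> i - D \<nu> i) \<le> 2 * R"
  using norm_triangle_ineq4[of "Dt \<nu> i" "D \<nu> i"] Dt_le[of \<nu> i] D_le[of \<nu> i] by linarith

lemma step_le: "norm (\<gamma> \<nu> *\<^sub>R (Dt \<nu> i - D \<nu> i)) \<le> 2 * R * \<gamma> \<nu>"
  using mult_left_mono[OF dist_Dt_le \<gamma>_nonneg] by (simp add: \<gamma>_nonneg mult_ac)

lemma square_summable_step: "square_summable (\<lambda>\<nu>. 2 * R * \<gamma> \<nu>)"
  by (rule square_summable_cmult) (rule \<gamma>_square)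

lemma D_consensus: "square_summable (\<lambda>\<nu>. norm (D \<nu> i - avg \<nu>))"
  unfolding avg_def
proof (rule consensus[where \<beta> = "\<lambda>\<nu>. 2 * R * \<gamma> \<nu>"])
  show "D (Suc \<nu>) i = (\<Sum>j\<in>UNIV. W \<nu> $ i $ j *\<^sub>R D \<nu> j)
      + (\<Sum>j\<in>UNIV. W \<nu> $ i $ j *\<^sub>R (\<gamma> \<nu> *\<^sub>R (Dt \<nu> j - D \<nu> j)))" for \<nu> i
    by (simp only: D_step U scaleR_add_right sum.distrib)
  show "norm (\<Sum>j\<in>UNIV. W \<nu> $ i $ j *\<^sub>R (\<gamma> \<nu> *\<^sub>R (Dt \<nu> j - D \<nu> j))) \<le> 2 * R * \<gamma> \<nu>" for \<nu> i
    by (rule norm_mix_le) (rule step_le)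
qed (rule square_summable_step)

lemma U_near_avg: "norm (U \<nu> i - avg \<nu>) \<le> norm (D \<nu> i - avg \<nu>) + 2 * R * \<gamma> \<nu>"
proof -
  have "U \<nu> i - avg \<nu> = (D \<nu> i - avg \<nu>) + \<gamma> \<nu> *\<^sub>R (Dt \<nu> i - D \<nu> i)"
    by (simp add: U)
  then show ?thesis
    using norm_triangle_mono[OF order_refl step_le] by metis
qed

lemma avg_Suc: "avg (Suc \<nu>) = avg \<nu> + average (\<lambda>i. \<gamma> \<nu> *\<^sub>R (Dt \<nu> i - D \<nu> i))"
  by (simp add: avg_def average_def D_step sum_mix) (simp add: U sum.distrib scaleR_add_right)

lemma avg_step_le: "norm (avg (Suc \<nu>) - avg \<nu>) \<le> 2 * R * \<gamma> \<nu>"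
  unfolding avg_Suc add_diff_cancel_left' by (rule norm_average_le) (rule step_le)

lemma D_step_square_summable: "square_summable (\<lambda>\<nu>. norm (D (Suc \<nu>) i - D \<nu> i))"
proof (rule square_summable_dominated)
  show "\<bar>norm (D (Suc \<nu>) i - D \<nu> i)\<bar>
      \<le> norm (D (Suc \<nu>) i - avg (Suc \<nu>)) + 2 * R * \<gamma> \<nu> + norm (D \<nu> i - avg \<nu>)" for \<nu>
    using norm_triangle_ineq[of "D (Suc \<nu>) i - avg (Suc \<nu>)" "avg (Suc \<nu>) - D \<nu> i"]
      norm_triangle_ineq4[of "avg (Suc \<nu>) - avg \<nu>" "D \<nu> i - avg \<nu>"] avg_step_le[of \<nu>]
    by simp
  show "square_summable (\<lambda>\<nu>. norm (D (Suc \<nu>) i - avg (Suc \<nu>)) + 2 * R * \<gamma> \<nu> + norm (D \<nu> i - avg \<nu>))"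
    using square_summable_shift[OF D_consensus, of 1 i]
    by (intro square_summable_add square_summable_step D_consensus) simp
qed

definition L :: real where
  "L = (\<Sum>i\<in>UNIV. grad_lipschitz R (T i))"

lemma grad_lipschitz_le_L: "grad_lipschitz R (T i) \<le> L"
  unfolding L_def by (rule member_le_sum) (auto simp: grad_lipschitz_nonneg)

lemma L_nonneg: "0 \<le> L"
  using grad_lipschitz_le_L grad_lipschitz_nonneg order_trans by blast

lemma grad_D_lipschitz_L:
  assumes "norm A \<le> R" and "norm A' \<le> R" and "norm Y \<le> R" and "norm Y' \<le> R"
  shows "norm (grad_D (T i) A Y - grad_D (T i) A' Y') \<le> L * (norm (A - A') + norm (Y - Y'))"
  by (rule order_trans[OF grad_D_lipschitz[OF assms]])
    (simp add: mult_right_mono grad_lipschitz_le_L)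

lemma xh_lipschitz:
  assumes "norm A \<le> R" and "norm A' \<le> R"
  shows "norm (xh i A - xh i A') \<le> L / (2 * \<mu>) * norm (A - A')"
  by (rule order_trans[OF en.xhat_lipschitz[OF assms code_le]])
    (intro mult_right_mono divide_right_mono grad_lipschitz_le_L, use \<mu> in auto)

text \<open>
  The contraction towards the optimal code competes with a drift of that code, which is at most
  proportional to the movement of the dictionary and hence square-summable.
\<close>

lemma code_error: "square_summable (\<lambda>\<nu>. norm (X \<nu> i - xh i (avg \<nu>)))"
proof -
  define Lx where "Lx = L / (2 * \<mu>)"
  have xh_Lx: "norm (xh i A - xh i A') \<le> Lx * norm (A - A')" if "norm A \<le> R" "norm A' \<le> R" for A A'
    unfolding Lx_def using that by (rule xh_lipschitz)
  let ?c = "\<lambda>\<nu>. 2 * Lx * norm (D \<nu> i - avg \<nu>) + 3 * Lx * (2 * R * \<gamma> \<nu>)"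
  have Lx: "0 \<le> Lx" using L_nonneg \<mu> by (simp add: Lx_def)
  show ?thesis
  proof (rule square_summable_recursion[where T = 1 and q = code_rate and c = ?c])
    show "norm (X (\<nu> + 1) i - xh i (avg (\<nu> + 1))) \<le> code_rate * norm (X \<nu> i - xh i (avg \<nu>)) + ?c \<nu>" for \<nu>
    proof -
      let ?d = "norm (U \<nu> i - avg \<nu>)"
      have old: "norm (X \<nu> i - xh i (U \<nu> i)) \<le> norm (X \<nu> i - xh i (avg \<nu>)) + Lx * ?d"
        using norm_triangle_ineq4[of "X \<nu> i - xh i (avg \<nu>)" "xh i (U \<nu> i) - xh i (avg \<nu>)"]
          xh_Lx[OF U_le avg_le, of \<nu> i \<nu>] by simp
      have "code_rate * norm (X \<nu> i - xh i (U \<nu> i))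
          \<le> code_rate * norm (X \<nu> i - xh i (avg \<nu>)) + code_rate * (Lx * ?d)"
        using mult_left_mono[OF old code_rate(1)] by (simp only: distrib_left)
      also have "code_rate * (Lx * ?d) \<le> 1 * (Lx * ?d)"
        using code_rate Lx by (intro mult_right_mono mult_nonneg_nonneg) (auto intro: less_imp_le)
      finally have prox: "norm (X (Suc \<nu>) i - xh i (U \<nu> i))
          \<le> code_rate * norm (X \<nu> i - xh i (avg \<nu>)) + Lx * ?d"
        using code_step_contracts[of \<nu> i] by linarith
      have "norm (xh i (U \<nu> i) - xh i (avg (Suc \<nu>))) \<le> Lx * norm (U \<nu> i - avg (Suc \<nu>))"
        by (rule xh_Lx[OF U_le avg_le])
      also have "\<dots> \<le> Lx * (?d + 2 * R * \<gamma> \<nu>)"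
        using norm_triangle_ineq4[of "U \<nu> i - avg \<nu>" "avg (Suc \<nu>) - avg \<nu>"] avg_step_le[of \<nu>]
        by (intro mult_left_mono Lx) simp
      finally have drift: "norm (xh i (U \<nu> i) - xh i (avg (Suc \<nu>))) \<le> Lx * (?d + 2 * R * \<gamma> \<nu>)" .
      have "Lx * ?d \<le> Lx * (norm (D \<nu> i - avg \<nu>) + 2 * R * \<gamma> \<nu>)"
        by (rule mult_left_mono[OF U_near_avg Lx])
      then show ?thesis
        using prox drift norm_triangle_ineq[of "X (Suc \<nu>) i - xh i (U \<nu> i)" "xh i (U \<nu> i) - xh i (avg (Suc \<nu>))"]
        by (simp add: algebra_simps)
    qed
    show "square_summable ?c"
      by (intro square_summable_add square_summable_cmult D_consensus \<gamma>_square)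
  qed (use code_rate in auto)
qed

lemma X_step_square_summable: "square_summable (\<lambda>\<nu>. norm (X (Suc \<nu>) i - X \<nu> i))"
proof (rule square_summable_dominated)
  let ?Lx = "L / (2 * \<mu>)"
  have Lx: "0 \<le> ?Lx" using L_nonneg \<mu> by simp
  show "\<bar>norm (X (Suc \<nu>) i - X \<nu> i)\<bar> \<le> norm (X (Suc \<nu>) i - xh i (avg (Suc \<nu>)))
      + ?Lx * (2 * R * \<gamma> \<nu>) + norm (X \<nu> i - xh i (avg \<nu>))" for \<nu>
    using norm_triangle_ineq[of "X (Suc \<nu>) i - xh i (avg (Suc \<nu>))" "xh i (avg (Suc \<nu>)) - X \<nu> i"]
      norm_triangle_ineq4[of "xh i (avg (Suc \<nu>)) - xh i (avg \<nu>)" "X \<nu> i - xh i (avg \<nu>)"]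
      xh_lipschitz[OF avg_le avg_le, of i "Suc \<nu>" \<nu>] mult_left_mono[OF avg_step_le[of \<nu>] Lx]
    by simp
  show "square_summable (\<lambda>\<nu>. norm (X (Suc \<nu>) i - xh i (avg (Suc \<nu>)))
      + ?Lx * (2 * R * \<gamma> \<nu>) + norm (X \<nu> i - xh i (avg \<nu>)))"
    using square_summable_shift[OF code_error, of 1 i]
    by (intro square_summable_add square_summable_cmult square_summable_step code_error) simp
qed

abbreviation G :: "nat \<Rightarrow> 'i \<Rightarrow> real^'k^'m" where
  "G \<nu> i \<equiv> grad_D (T i) (D \<nu> i) (X \<nu> i)"

text \<open>
  Mixing preserves the sum, and the correction replaces the old gradients by the new ones.  So the
  average of the trackers is exactly the average of the current local gradients.
\<close>

lemma sum_tracker: "(\<Sum>i\<in>UNIV. \<Theta> \<nu> i) = (\<Sum>i\<in>UNIV. G \<nu> i)"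
proof (induction \<nu>)
  case 0
  then show ?case by (rule \<Theta>_start)
next
  case (Suc \<nu>)
  have "(\<Sum>i\<in>UNIV. \<Theta> (Suc \<nu>) i) = (\<Sum>i\<in>UNIV. \<Theta> \<nu> i) + ((\<Sum>i\<in>UNIV. G (Suc \<nu>) i) - (\<Sum>i\<in>UNIV. G \<nu> i))"
    by (simp only: \<Theta>_step sum.distrib sum_mix sum_subtractf)
  then show ?case by (simp add: Suc)
qed

lemma tracker_consensus: "square_summable (\<lambda>\<nu>. norm (\<Theta> \<nu> i - average (\<Theta> \<nu>)))"
proof (rule consensus[OF \<Theta>_step])
  let ?\<beta> = "\<lambda>\<nu> i. L * (norm (D (Suc \<nu>) i - D \<nu> i) + norm (X (Suc \<nu>) i - X \<nu> i))"
  show "norm (G (Suc \<nu>) i - G \<nu> i) \<le> (\<Sum>i\<in>UNIV. ?\<beta> \<nu> i)" for \<nu> i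
  proof (rule order_trans[OF grad_D_lipschitz_L])
    show "?\<beta> \<nu> i \<le> (\<Sum>i\<in>UNIV. ?\<beta> \<nu> i)"
      by (rule member_le_sum) (auto intro: mult_nonneg_nonneg L_nonneg add_nonneg_nonneg)
  qed (rule D_le X_le)+
  show "square_summable (\<lambda>\<nu>. \<Sum>i\<in>UNIV. ?\<beta> \<nu> i)"
    by (intro square_summable_sum square_summable_cmult square_summable_add
        D_step_square_summable X_step_square_summable) simp
qed

text \<open>
  The gradient of \<open>opt_value\<close> (by the envelope principle, the codes may be kept fixed when
  differentiating).
\<close>

definition H :: "real^'k^'m \<Rightarrow> real^'k^'m" where
  "H A = (\<Sum>i\<in>UNIV. grad_D (T i) A (xh i A))"

lemma H_lipschitz: "\<exists>K\<ge>0. \<forall>A A'. norm A \<le> R \<longrightarrow> norm A' \<le> R \<longrightarrow> norm (H A - H A') \<le> K * norm (A - A')"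
proof (intro exI conjI allI impI)
  let ?K = "of_nat CARD('i) * (L * (1 + L / (2 * \<mu>)))"
  show "0 \<le> ?K" using L_nonneg \<mu> by simp
  fix A A' :: "real^'k^'m"
  assume A: "norm A \<le> R" "norm A' \<le> R"
  have "norm (grad_D (T i) A (xh i A) - grad_D (T i) A' (xh i A')) \<le> L * (1 + L / (2 * \<mu>)) * norm (A - A')" for i
  proof -
    have "norm (A - A') + norm (xh i A - xh i A') \<le> (1 + L / (2 * \<mu>)) * norm (A - A')"
      using xh_lipschitz[OF A, of i] by (simp add: distrib_right)
    from mult_left_mono[OF this L_nonneg] show ?thesis
      by (intro order_trans[OF grad_D_lipschitz_L[OF A xh_le xh_le]]) (simp add: mult.assoc)
  qed
  then have "norm (\<Sum>i\<in>UNIV. grad_D (T i) A (xh i A) - grad_D (T i) A' (xh i A'))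
      \<le> (\<Sum>i\<in>(UNIV::'i set). L * (1 + L / (2 * \<mu>)) * norm (A - A'))"
    by (intro sum_norm_le)
  then show "norm (H A - H A') \<le> ?K * norm (A - A')"
    by (simp add: H_def sum_subtractf mult.assoc)
qed

lemma H_bounded: "\<exists>K\<ge>0. \<forall>A. norm A \<le> R \<longrightarrow> norm (H A) \<le> K"
proof (intro exI conjI allI impI)
  let ?K = "\<Sum>i\<in>UNIV. (R\<^sup>2 + norm (T i)) * R"
  show "0 \<le> ?K" using R_nonneg by (intro sum_nonneg) simp
  fix A :: "real^'k^'m" assume A: "norm A \<le> R"
  show "norm (H A) \<le> ?K"
    unfolding H_def by (intro sum_norm_le norm_grad_D_le A xh_le)
qed

text \<open>
  How far the gradient that agent \<open>i\<close> uses is from the gradient at the average dictionary.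
\<close>

definition tracking_error :: "nat \<Rightarrow> 'i \<Rightarrow> real" where
  "tracking_error \<nu> i = norm (of_nat CARD('i) *\<^sub>R \<Theta> \<nu> i - H (avg \<nu>))"

lemma tracking_error_square_summable: "square_summable (\<lambda>\<nu>. tracking_error \<nu> i)"
proof (rule square_summable_dominated)
  let ?n = "real CARD('i)"
  let ?e = "\<lambda>\<nu> j. L * (norm (D \<nu> j - avg \<nu>) + norm (X \<nu> j - xh j (avg \<nu>)))"
  show "\<bar>tracking_error \<nu> i\<bar> \<le> ?n * norm (\<Theta> \<nu> i - average (\<Theta> \<nu>)) + (\<Sum>j\<in>UNIV. ?e \<nu> j)" for \<nu>
  proof -
    have "of_nat CARD('i) *\<^sub>R \<Theta> \<nu> i - H (avg \<nu>) = of_nat CARD('i) *\<^sub>R (\<Theta> \<nu> i - average (\<Theta> \<nu>))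
        + (\<Sum>j\<in>UNIV. G \<nu> j - grad_D (T j) (avg \<nu>) (xh j (avg \<nu>)))"
      by (simp add: average_def sum_tracker H_def sum_subtractf scaleR_diff_right)
    moreover have "norm (\<Sum>j\<in>UNIV. G \<nu> j - grad_D (T j) (avg \<nu>) (xh j (avg \<nu>))) \<le> (\<Sum>j\<in>UNIV. ?e \<nu> j)"
      by (intro sum_norm_le grad_D_lipschitz_L D_le avg_le X_le xh_le)
    ultimately show ?thesis
      unfolding tracking_error_def
      using norm_triangle_mono[of "of_nat CARD('i) *\<^sub>R (\<Theta> \<nu> i - average (\<Theta> \<nu>))" "?n * norm (\<Theta> \<nu> i - average (\<Theta> \<nu>))"]
      by simp
  qed
  show "square_summable (\<lambda>\<nu>. ?n * norm (\<Theta> \<nu> i - average (\<Theta> \<nu>)) + (\<Sum>j\<in>UNIV. ?e \<nu> j))"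
    by (intro square_summable_add square_summable_cmult square_summable_sum
        tracker_consensus D_consensus code_error) simp
qed

section \<open>Descent of the optimal value\<close>

text \<open>
  The linear term of the subproblem is the tracked gradient minus the local one, so optimality
  combines the change of the local gradient, the proximal term and the tracked gradient.
\<close>

lemma dict_step_variational:
  assumes "Z \<in> \<D>"
  shows "0 \<le> (grad_D (T i) (Dt \<nu> i) (X \<nu> i) - G \<nu> i + \<tau>D \<nu> i *\<^sub>R (Dt \<nu> i - D \<nu> i)
    + of_nat CARD('i) *\<^sub>R \<Theta> \<nu> i) \<bullet> (Z - Dt \<nu> i)"
  using dict_variational[OF Dt \<D>(1) assms] by (simp add: algebra_simps)

lemma norm_dict_gradient_change_le:
  "norm (grad_D (T i) (Dt \<nu> i) (X \<nu> i) - G \<nu> i + \<tau>D \<nu> i *\<^sub>R (Dt \<nu> i - D \<nu> i))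
    \<le> (L + \<tau>max) * norm (Dt \<nu> i - D \<nu> i)"
proof -
  have "norm (grad_D (T i) (Dt \<nu> i) (X \<nu> i) - G \<nu> i) \<le> L * norm (Dt \<nu> i - D \<nu> i)"
    using grad_D_lipschitz_L[OF Dt_le D_le X_le X_le, of i \<nu> i \<nu> i \<nu> i \<nu> i] by simp
  moreover have "norm (\<tau>D \<nu> i *\<^sub>R (Dt \<nu> i - D \<nu> i)) \<le> \<tau>max * norm (Dt \<nu> i - D \<nu> i)"
    using \<tau>D(1) \<tau>D(2,3)[of \<nu> i] by (simp add: mult_right_mono)
  ultimately show ?thesis
    unfolding distrib_right by (rule norm_triangle_mono)
qed

lemma tau_max_nonneg: "0 \<le> \<tau>max"
  using \<tau>X[of 0 undefined] by linarith

lemma tracking_error_nonneg: "0 \<le> tracking_error \<nu> i"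
  by (simp add: tracking_error_def)

lemma tracked_gradient_inner_le:
  assumes "norm v \<le> 2 * R"
  shows "\<bar>(of_nat CARD('i) *\<^sub>R \<Theta> \<nu> i) \<bullet> v - H (avg \<nu>) \<bullet> v\<bar> \<le> 2 * R * tracking_error \<nu> i"
proof -
  have "\<bar>(of_nat CARD('i) *\<^sub>R \<Theta> \<nu> i - H (avg \<nu>)) \<bullet> v\<bar> \<le> tracking_error \<nu> i * norm v"
    unfolding tracking_error_def by (rule Cauchy_Schwarz_ineq2)
  also have "\<dots> \<le> tracking_error \<nu> i * (2 * R)"
    using assms tracking_error_nonneg by (rule mult_left_mono)
  finally show ?thesis by (simp add: inner_diff_left mult.commute)
qed

text \<open>
  Test the optimality of \<open>Dt \<nu> i\<close> with the feasible companion of \<open>D \<nu> i\<close>.  The local gradient is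
  monotone and can be dropped; the tracked gradient is \<open>H\<close> up to the tracking error.
\<close>

lemma descent_direction:
  "\<exists>K\<ge>0. \<forall>\<nu> i. \<tau>min * (norm (Dt \<nu> i - D \<nu> i))\<^sup>2 + H (avg \<nu>) \<bullet> (Dt \<nu> i - D \<nu> i)
    \<le> K * (infeasibility \<nu> + tracking_error \<nu> i)"
proof -
  obtain F where F: "0 \<le> F" "\<And>\<nu> i. \<exists>c\<in>\<D>. norm (D \<nu> i - c) \<le> F * infeasibility \<nu>"
    using near_feasible by blast
  obtain N where N: "0 \<le> N" "\<And>A. norm A \<le> R \<Longrightarrow> norm (H A) \<le> N"
    using H_bounded by blast
  \<comment> \<open>Bounds the gradient of the subproblem at its minimizer, up to the tracking error.\<close>
  define M where "M = (L + \<tau>max) * (2 * R) + N"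
  have M: "0 \<le> M"
    using L_nonneg tau_max_nonneg R_nonneg N by (simp add: M_def)
  let ?K = "M * F + F + 2 * R"
  have "\<tau>min * (norm (Dt \<nu> i - D \<nu> i))\<^sup>2 + H (avg \<nu>) \<bullet> (Dt \<nu> i - D \<nu> i)
      \<le> ?K * (infeasibility \<nu> + tracking_error \<nu> i)" for \<nu> i
  proof -
    let ?v = "Dt \<nu> i - D \<nu> i" and ?\<delta> = "tracking_error \<nu> i" and ?\<rho> = "infeasibility \<nu>"
    let ?g = "grad_D (T i) (Dt \<nu> i) (X \<nu> i) - G \<nu> i" and ?t = "of_nat CARD('i) *\<^sub>R \<Theta> \<nu> i"
    let ?A = "?g + \<tau>D \<nu> i *\<^sub>R ?v + ?t"
    have pos: "0 \<le> ?\<delta>" "0 \<le> ?\<rho>" "?\<rho> \<le> 1"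
      by (rule tracking_error_nonneg infeasibility_nonneg infeasibility_le_1)+
    obtain c where c: "c \<in> \<D>" "norm (D \<nu> i - c) \<le> F * ?\<rho>"
      using F(2) by blast
    have "norm ?t \<le> N + ?\<delta>"
      using norm_triangle_sub[of ?t "H (avg \<nu>)"] N(2)[OF avg_le[of \<nu>]]
      by (simp add: tracking_error_def)
    moreover have "norm (?g + \<tau>D \<nu> i *\<^sub>R ?v) \<le> (L + \<tau>max) * (2 * R)"
      using norm_dict_gradient_change_le[of i \<nu>] L_nonneg tau_max_nonneg
        mult_left_mono[OF dist_Dt_le[of \<nu> i], of "L + \<tau>max"] by linarith
    ultimately have "norm ?A \<le> (L + \<tau>max) * (2 * R) + (N + ?\<delta>)"
      by (intro norm_triangle_mono)
    then have A: "norm ?A \<le> M + ?\<delta>"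
      by (simp add: M_def)
    have "0 \<le> ?A \<bullet> (c - Dt \<nu> i)"
      by (rule dict_step_variational[OF c(1)])
    also have "c - Dt \<nu> i = (c - D \<nu> i) - ?v" by simp
    finally have "?A \<bullet> ?v \<le> ?A \<bullet> (c - D \<nu> i)"
      by (simp only: inner_diff_right)
    also have "\<dots> \<le> norm ?A * norm (c - D \<nu> i)"
      by (rule norm_cauchy_schwarz)
    also have "\<dots> \<le> (M + ?\<delta>) * (F * ?\<rho>)"
      using A c(2) M pos by (intro mult_mono) (auto simp: norm_minus_commute)
    also have "\<dots> \<le> M * F * ?\<rho> + F * ?\<delta>"
      using mult_left_mono[OF pos(3), of "F * ?\<delta>"] F(1) pos by (simp add: algebra_simps)
    finally have upper: "?A \<bullet> ?v \<le> M * F * ?\<rho> + F * ?\<delta>" .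
    have "?A \<bullet> ?v = ?g \<bullet> ?v + \<tau>D \<nu> i * (norm ?v)\<^sup>2 + ?t \<bullet> ?v"
      by (simp add: inner_add_left power2_norm_eq_inner)
    moreover have "0 \<le> ?g \<bullet> ?v"
      by (rule grad_D_monotone)
    moreover have "\<tau>min * (norm ?v)\<^sup>2 \<le> \<tau>D \<nu> i * (norm ?v)\<^sup>2"
      using \<tau>D(2) by (simp add: mult_right_mono)
    moreover have "H (avg \<nu>) \<bullet> ?v \<le> ?t \<bullet> ?v + 2 * R * ?\<delta>"
      using tracked_gradient_inner_le[OF dist_Dt_le[of \<nu> i], of \<nu> i] by linarith
    ultimately have "\<tau>min * (norm ?v)\<^sup>2 + H (avg \<nu>) \<bullet> ?v \<le> M * F * ?\<rho> + F * ?\<delta> + 2 * R * ?\<delta>"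
      using upper by linarith
    also have "\<dots> \<le> ?K * (?\<rho> + ?\<delta>)"
    proof -
      have "0 \<le> (F + 2 * R) * ?\<rho>" "0 \<le> M * F * ?\<delta>"
        using F(1) R_nonneg M pos by simp_all
      then show ?thesis by (simp add: algebra_simps)
    qed
    finally show ?thesis .
  qed
  moreover have "0 \<le> ?K" using M F(1) R_nonneg by simp
  ultimately show ?thesis by blast
qed

text \<open>
  The objective with the codes minimized out.
\<close>

definition opt_value :: "real^'k^'m \<Rightarrow> real" where
  "opt_value A = (\<Sum>i\<in>UNIV. fit (T i) A (xh i A) + reg lam \<mu> (xh i A))"

lemma opt_value_nonneg: "0 \<le> opt_value A"
  unfolding opt_value_def
  using en.obj_lower \<mu> by (intro sum_nonneg) (meson mult_nonneg_nonneg less_imp_le zero_le_power2 order_trans)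

text \<open>
  The optimal codes at \<open>A\<close> are feasible competitors at \<open>A + d\<close>, and for fixed codes the fit is
  quadratic in the dictionary.
\<close>

lemma opt_value_upper:
  "opt_value (A + d) \<le> opt_value A + H A \<bullet> d + of_nat CARD('i) * R\<^sup>2 / 2 * (norm d)\<^sup>2"
proof -
  have "fit (T i) (A + d) (xh i (A + d)) + reg lam \<mu> (xh i (A + d))
      \<le> fit (T i) A (xh i A) + reg lam \<mu> (xh i A) + grad_D (T i) A (xh i A) \<bullet> d + R\<^sup>2 / 2 * (norm d)\<^sup>2" for i
  proof -
    have "norm (d ** xh i A) \<le> R * norm d"
      using norm_matrix_mult_le[of d "xh i A"] mult_left_mono[OF xh_le[of i A] norm_ge_zero[of d]]
      by (simp add: mult.commute)
    then have "(norm (d ** xh i A))\<^sup>2 / 2 \<le> R\<^sup>2 / 2 * (norm d)\<^sup>2"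
      by (rule half_power2_norm_le)
    then show ?thesis
      using en.xhat_minimal[OF en.xhat_in, of i "A + d" A] fit_expand_D[of "T i" A d "xh i A"] by linarith
  qed
  then have "opt_value (A + d) \<le> (\<Sum>i\<in>UNIV. fit (T i) A (xh i A) + reg lam \<mu> (xh i A)
      + grad_D (T i) A (xh i A) \<bullet> d + R\<^sup>2 / 2 * (norm d)\<^sup>2)"
    unfolding opt_value_def by (rule sum_mono)
  then show ?thesis
    by (simp add: opt_value_def H_def sum.distrib inner_sum_left)
qed

text \<open>
  In each step \<open>opt_value\<close> at the average dictionary decreases by a multiple of the summand, up to
  errors \<open>\<gamma> \<cdot> infeasibility\<close>, \<open>\<gamma> \<cdot> tracking_error\<close> and \<open>\<gamma>\<^sup>2\<close>, which are summable.
\<close>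

lemma summable_displacement: "summable (\<lambda>\<nu>. \<gamma> \<nu> * (\<Sum>i\<in>UNIV. (norm (Dt \<nu> i - D \<nu> i))\<^sup>2))"
proof -
  obtain K where K: "0 \<le> K" "\<And>\<nu> i. \<tau>min * (norm (Dt \<nu> i - D \<nu> i))\<^sup>2
      \<le> K * (infeasibility \<nu> + tracking_error \<nu> i) - H (avg \<nu>) \<bullet> (Dt \<nu> i - D \<nu> i)"
    using descent_direction by (auto simp: le_diff_eq)
  let ?n = "real CARD('i)"
  let ?Q = "?n * R\<^sup>2 / 2"
  define e where "e \<nu> = K * (\<gamma> \<nu> * infeasibility \<nu>)
      + (K / ?n) * (\<Sum>i\<in>UNIV. \<gamma> \<nu> * tracking_error \<nu> i) + ?Q * (2 * R * \<gamma> \<nu>)\<^sup>2" for \<nu>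
  have "summable (\<lambda>\<nu>. \<tau>min / ?n * (\<gamma> \<nu> * (\<Sum>i\<in>UNIV. (norm (Dt \<nu> i - D \<nu> i))\<^sup>2)))"
  proof (rule summable_of_decrease[of _ "\<lambda>\<nu>. opt_value (avg \<nu>)" e])
    fix \<nu>
    show "0 \<le> \<tau>min / ?n * (\<gamma> \<nu> * (\<Sum>i\<in>UNIV. (norm (Dt \<nu> i - D \<nu> i))\<^sup>2))"
      using \<tau>D(1) \<gamma>_nonneg by (simp add: sum_nonneg)
    show "0 \<le> opt_value (avg \<nu>)" by (rule opt_value_nonneg)
    show "0 \<le> e \<nu>"
      unfolding e_def using K(1) \<gamma>_nonneg infeasibility_nonneg tracking_error_nonneg
      by (intro add_nonneg_nonneg mult_nonneg_nonneg sum_nonneg) auto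
    show "\<tau>min / ?n * (\<gamma> \<nu> * (\<Sum>i\<in>UNIV. (norm (Dt \<nu> i - D \<nu> i))\<^sup>2))
        \<le> opt_value (avg \<nu>) - opt_value (avg (Suc \<nu>)) + e \<nu>"
    proof -
      let ?d = "avg (Suc \<nu>) - avg \<nu>"
      have "(\<Sum>i\<in>UNIV. \<tau>min * (norm (Dt \<nu> i - D \<nu> i))\<^sup>2)
          \<le> (\<Sum>i\<in>UNIV. K * (infeasibility \<nu> + tracking_error \<nu> i) - H (avg \<nu>) \<bullet> (Dt \<nu> i - D \<nu> i))"
        by (rule sum_mono) (rule K(2))
      also have "\<dots> = ?n * (K * infeasibility \<nu>) + K * (\<Sum>i\<in>UNIV. tracking_error \<nu> i)
          - H (avg \<nu>) \<bullet> (\<Sum>i\<in>UNIV. Dt \<nu> i - D \<nu> i)"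
        by (simp add: sum_subtractf sum.distrib distrib_left sum_distrib_left inner_sum_right inner_diff_right)
      finally have "\<gamma> \<nu> / ?n * (\<Sum>i\<in>UNIV. \<tau>min * (norm (Dt \<nu> i - D \<nu> i))\<^sup>2)
          \<le> \<gamma> \<nu> / ?n * (?n * (K * infeasibility \<nu>) + K * (\<Sum>i\<in>UNIV. tracking_error \<nu> i)
            - H (avg \<nu>) \<bullet> (\<Sum>i\<in>UNIV. Dt \<nu> i - D \<nu> i))"
        using \<gamma>_nonneg by (intro mult_left_mono) auto
      moreover have "H (avg \<nu>) \<bullet> ?d = \<gamma> \<nu> / ?n * (H (avg \<nu>) \<bullet> (\<Sum>i\<in>UNIV. Dt \<nu> i - D \<nu> i))"
        by (simp add: avg_Suc average_def scaleR_right.sum[symmetric])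
      moreover have "opt_value (avg (Suc \<nu>)) \<le> opt_value (avg \<nu>) + H (avg \<nu>) \<bullet> ?d + ?Q * (norm ?d)\<^sup>2"
        using opt_value_upper[of "avg \<nu>" ?d] by simp
      moreover have "?Q * (norm ?d)\<^sup>2 \<le> ?Q * (2 * R * \<gamma> \<nu>)\<^sup>2"
        by (intro mult_left_mono power_mono avg_step_le) auto
      moreover have "\<gamma> \<nu> / ?n * (?n * (K * infeasibility \<nu>) + K * (\<Sum>i\<in>UNIV. tracking_error \<nu> i)
            - H (avg \<nu>) \<bullet> (\<Sum>i\<in>UNIV. Dt \<nu> i - D \<nu> i))
          = K * (\<gamma> \<nu> * infeasibility \<nu>) + (K / ?n) * (\<Sum>i\<in>UNIV. \<gamma> \<nu> * tracking_error \<nu> i)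
            - \<gamma> \<nu> / ?n * (H (avg \<nu>) \<bullet> (\<Sum>i\<in>UNIV. Dt \<nu> i - D \<nu> i))"
        unfolding sum_distrib_left[symmetric] by (simp add: field_simps)
      moreover have "\<gamma> \<nu> / ?n * (\<Sum>i\<in>UNIV. \<tau>min * (norm (Dt \<nu> i - D \<nu> i))\<^sup>2)
          = \<tau>min / ?n * (\<gamma> \<nu> * (\<Sum>i\<in>UNIV. (norm (Dt \<nu> i - D \<nu> i))\<^sup>2))"
        unfolding sum_distrib_left[symmetric] by simp
      ultimately show ?thesis
        unfolding e_def by linarith
    qed
  next
    have "summable (\<lambda>\<nu>. (2 * R * \<gamma> \<nu>)\<^sup>2)"
      using square_summable_step by (simp add: square_summable_def)
    then show "summable e"
      unfolding e_def
      by (intro summable_add summable_mult summable_sum summable_infeasibility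
          summable_mult_square_summable \<gamma>_square tracking_error_square_summable)
  qed
  then show ?thesis
    using \<tau>D(1) by (simp add: summable_cmult_iff)
qed

section \<open>Stationarity of limit points\<close>

text \<open>
  Testing the dictionary step of one agent with \<open>Z\<close> bounds the gap by \<open>norm (Dt \<nu> i - D \<nu> i)\<close> plus
  square-summable errors; so \<open>\<gamma>\<close> times its square is summable.  As a Lipschitz function of the average
  dictionary, the gap moves by at most a multiple of \<open>\<gamma>\<close>.  The gap is used instead of the
  displacement itself because the displacement also depends on \<open>\<tau>D \<nu> i\<close>, which may jump.
\<close>

lemma stationarity_gap_tendsto_zero:
  assumes Z: "Z \<in> \<D>"
  shows "(\<lambda>\<nu>. max 0 (- (H (avg \<nu>) \<bullet> (Z - avg \<nu>)))) \<longlonglongrightarrow> 0"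
proof -
  obtain N where N: "0 \<le> N" "\<And>A. norm A \<le> R \<Longrightarrow> norm (H A) \<le> N"
    using H_bounded by blast
  obtain K where K: "0 \<le> K" "\<And>A A'. norm A \<le> R \<Longrightarrow> norm A' \<le> R \<Longrightarrow> norm (H A - H A') \<le> K * norm (A - A')"
    using H_lipschitz by blast
  define s where "s \<nu> = H (avg \<nu>) \<bullet> (Z - avg \<nu>)" for \<nu>
  define p where "p \<nu> = max 0 (- s \<nu>)" for \<nu>
  have Z_avg: "norm (Z - avg \<nu>) \<le> 2 * R" for \<nu>
    using norm_triangle_ineq4[of Z "avg \<nu>"] dict_le[OF Z] avg_le[of \<nu>] by linarith
  have slow: "\<bar>p (Suc \<nu>) - p \<nu>\<bar> \<le> (4 * R\<^sup>2 * K + 2 * R * N) * \<gamma> \<nu>" for \<nu>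
  proof -
    let ?d = "avg (Suc \<nu>) - avg \<nu>"
    have "norm (H (avg (Suc \<nu>)) - H (avg \<nu>)) \<le> K * (2 * R * \<gamma> \<nu>)"
      using K(2)[OF avg_le avg_le, of "Suc \<nu>" \<nu>] mult_left_mono[OF avg_step_le[of \<nu>] K(1)] by linarith
    then have 1: "\<bar>(H (avg (Suc \<nu>)) - H (avg \<nu>)) \<bullet> (Z - avg (Suc \<nu>))\<bar> \<le> K * (2 * R * \<gamma> \<nu>) * (2 * R)"
      using Z_avg[of "Suc \<nu>"] K(1) R_nonneg \<gamma>_nonneg
      by (intro order_trans[OF Cauchy_Schwarz_ineq2] mult_mono) auto
    have 2: "\<bar>H (avg \<nu>) \<bullet> ?d\<bar> \<le> N * (2 * R * \<gamma> \<nu>)"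
      using N(2)[OF avg_le] avg_step_le[of \<nu>] N(1)
      by (intro order_trans[OF Cauchy_Schwarz_ineq2] mult_mono) auto
    have "s (Suc \<nu>) - s \<nu> = (H (avg (Suc \<nu>)) - H (avg \<nu>)) \<bullet> (Z - avg (Suc \<nu>)) - H (avg \<nu>) \<bullet> ?d"
      by (simp add: s_def inner_diff_left inner_diff_right)
    moreover have "\<bar>p (Suc \<nu>) - p \<nu>\<bar> \<le> \<bar>s (Suc \<nu>) - s \<nu>\<bar>"
      by (simp add: p_def max_def abs_if)
    moreover have "K * (2 * R * \<gamma> \<nu>) * (2 * R) + N * (2 * R * \<gamma> \<nu>) = (4 * R\<^sup>2 * K + 2 * R * N) * \<gamma> \<nu>"
      by (simp add: power2_eq_square algebra_simps)
    ultimately show ?thesis using 1 2 by linarith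
  qed
  \<comment> \<open>The displacement is controlled for every agent, so any single one can serve as witness.\<close>
  define i :: 'i where "i = undefined"
  define M where "M = (L + \<tau>max) * (2 * R) + 2 * R + N"
  have M: "0 \<le> M"
    using L_nonneg tau_max_nonneg R_nonneg N by (simp add: M_def)
  have gap: "p \<nu> \<le> M * (norm (Dt \<nu> i - D \<nu> i) + tracking_error \<nu> i + norm (D \<nu> i - avg \<nu>))" for \<nu>
  proof -
    let ?v = "Dt \<nu> i - D \<nu> i" and ?\<delta> = "tracking_error \<nu> i" and ?e = "D \<nu> i - avg \<nu>"
    let ?g = "grad_D (T i) (Dt \<nu> i) (X \<nu> i) - G \<nu> i + \<tau>D \<nu> i *\<^sub>R ?v" and ?t = "of_nat CARD('i) *\<^sub>R \<Theta> \<nu> i"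
    have pos: "0 \<le> ?\<delta>" by (rule tracking_error_nonneg)
    have Z_Dt: "norm (Z - Dt \<nu> i) \<le> 2 * R"
      using norm_triangle_ineq4[of Z "Dt \<nu> i"] dict_le[OF Z] Dt_le[of \<nu> i] by linarith
    have "?g \<bullet> (Z - Dt \<nu> i) \<le> ((L + \<tau>max) * norm ?v) * (2 * R)"
      using norm_dict_gradient_change_le[of i \<nu>] Z_Dt L_nonneg tau_max_nonneg
      by (intro order_trans[OF norm_cauchy_schwarz] mult_mono) auto
    moreover have "0 \<le> ?g \<bullet> (Z - Dt \<nu> i) + ?t \<bullet> (Z - Dt \<nu> i)"
      using dict_step_variational[OF Z, of i \<nu>] by (simp add: inner_add_left)
    moreover have "?t \<bullet> (Z - Dt \<nu> i) \<le> H (avg \<nu>) \<bullet> (Z - Dt \<nu> i) + 2 * R * ?\<delta>"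
      using tracked_gradient_inner_le[OF Z_Dt, of \<nu> i] by linarith
    moreover have "\<bar>H (avg \<nu>) \<bullet> ?v\<bar> \<le> N * norm ?v" "\<bar>H (avg \<nu>) \<bullet> ?e\<bar> \<le> N * norm ?e"
      using N(2)[OF avg_le] by (auto intro!: order_trans[OF Cauchy_Schwarz_ineq2] mult_right_mono)
    moreover have "s \<nu> = H (avg \<nu>) \<bullet> (Z - Dt \<nu> i) + H (avg \<nu>) \<bullet> ?v + H (avg \<nu>) \<bullet> ?e"
      by (simp add: s_def inner_diff_right)
    ultimately have "- s \<nu> \<le> ((L + \<tau>max) * norm ?v) * (2 * R) + 2 * R * ?\<delta> + N * norm ?v + N * norm ?e"
      by linarith
    also have "\<dots> \<le> M * (norm ?v + ?\<delta> + norm ?e)"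
    proof -
      have "0 \<le> (L + \<tau>max) * (2 * R)" using L_nonneg tau_max_nonneg R_nonneg by simp
      then have "0 \<le> 2 * R * norm ?v" "0 \<le> (L + \<tau>max) * (2 * R) * ?\<delta>" "0 \<le> N * ?\<delta>"
        "0 \<le> (L + \<tau>max) * (2 * R) * norm ?e" "0 \<le> 2 * R * norm ?e"
        using R_nonneg N(1) pos by (auto intro!: mult_nonneg_nonneg)
      then show ?thesis by (simp add: M_def algebra_simps)
    qed
    finally show ?thesis
      using M pos by (simp add: p_def)
  qed
  have "summable (\<lambda>\<nu>. \<gamma> \<nu> * (p \<nu>)\<^sup>2)"
  proof (rule summable_comparison_test)
    let ?b = "\<lambda>\<nu>. 3 * M\<^sup>2 * (\<gamma> \<nu> * (\<Sum>j\<in>UNIV. (norm (Dt \<nu> j - D \<nu> j))\<^sup>2)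
        + (tracking_error \<nu> i)\<^sup>2 + (norm (D \<nu> i - avg \<nu>))\<^sup>2)"
    have "\<gamma> \<nu> * (p \<nu>)\<^sup>2 \<le> ?b \<nu>" for \<nu>
    proof -
      let ?v = "norm (Dt \<nu> i - D \<nu> i)" and ?\<delta> = "tracking_error \<nu> i" and ?e = "norm (D \<nu> i - avg \<nu>)"
      have "(p \<nu>)\<^sup>2 \<le> (M * (?v + ?\<delta> + ?e))\<^sup>2"
        by (intro power_mono gap) (simp add: p_def)
      also have "\<dots> \<le> M\<^sup>2 * (3 * (?v\<^sup>2 + ?\<delta>\<^sup>2 + ?e\<^sup>2))"
        unfolding power_mult_distrib
        using zero_le_power2[of "?v - ?\<delta>"] zero_le_power2[of "?v - ?e"] zero_le_power2[of "?\<delta> - ?e"]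
        by (intro mult_left_mono) (simp_all add: power2_eq_square algebra_simps)
      finally have "\<gamma> \<nu> * (p \<nu>)\<^sup>2 \<le> \<gamma> \<nu> * (M\<^sup>2 * (3 * (?v\<^sup>2 + ?\<delta>\<^sup>2 + ?e\<^sup>2)))"
        using \<gamma>_nonneg by (rule mult_left_mono)
      also have "\<dots> = 3 * M\<^sup>2 * (\<gamma> \<nu> * ?v\<^sup>2 + \<gamma> \<nu> * ?\<delta>\<^sup>2 + \<gamma> \<nu> * ?e\<^sup>2)"
        by (simp add: algebra_simps)
      also have "\<dots> \<le> ?b \<nu>"
      proof (intro mult_left_mono add_mono)
        show "?v\<^sup>2 \<le> (\<Sum>j\<in>UNIV. (norm (Dt \<nu> j - D \<nu> j))\<^sup>2)"
          by (rule member_le_sum) auto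
      qed (auto simp: \<gamma>_nonneg \<gamma>_le_1 mult_left_le_one_le)
      finally show ?thesis .
    qed
    then show "\<exists>N. \<forall>\<nu>\<ge>N. norm (\<gamma> \<nu> * (p \<nu>)\<^sup>2) \<le> ?b \<nu>"
      using \<gamma>_nonneg by (simp add: abs_mult)
    show "summable ?b"
      using tracking_error_square_summable[of i] D_consensus[of i]
      by (intro summable_add summable_mult summable_displacement) (simp_all add: square_summable_def)
  qed
  then have "p \<longlonglongrightarrow> 0"
    by (intro slowly_varying_tendsto_zero[OF _ \<gamma>_nonneg \<gamma>_le_1 \<gamma>_diverges \<gamma>_square slow])
      (simp_all add: p_def)
  then show ?thesis by (simp add: p_def[abs_def] s_def)
qed

theorem limit_points:
  assumes r: "strict_mono r" and lim: "(\<lambda>k. avg (r k)) \<longlonglongrightarrow> A"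
  shows limit_feasible: "A \<in> \<D>"
    and limit_stationary: "Z \<in> \<D> \<Longrightarrow> 0 \<le> H A \<bullet> (Z - A)"
    and limit_code: "(\<lambda>k. X (r k) i) \<longlonglongrightarrow> xh i A"
proof -
  have along: "(\<lambda>k. a (r k)) \<longlonglongrightarrow> l" if "a \<longlonglongrightarrow> l" for a :: "nat \<Rightarrow> real" and l
    using LIMSEQ_subseq_LIMSEQ[OF that r] by (simp add: o_def)
  have A: "norm A \<le> R"
    using tendsto_norm[OF lim] by (rule LIMSEQ_le_const2) (auto intro: avg_le)
  have gap: "(\<lambda>k. norm (avg (r k) - A)) \<longlonglongrightarrow> 0"
    using tendsto_norm_zero[OF LIM_zero[OF lim]] .
  show "A \<in> \<D>"
  proof -
    obtain F where F: "\<And>\<nu> i. \<exists>c\<in>\<D>. norm (D \<nu> i - c) \<le> F * infeasibility \<nu>"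
      using near_feasible by blast
    from F[of _ undefined] obtain c where c: "\<And>\<nu>. c \<nu> \<in> \<D>"
        "\<And>\<nu>. norm (D \<nu> undefined - c \<nu>) \<le> F * infeasibility \<nu>"
      by metis
    have "(\<lambda>\<nu>. norm (D \<nu> undefined - avg \<nu>) + F * infeasibility \<nu>) \<longlonglongrightarrow> 0 + F * 0"
      by (intro tendsto_intros infeasibility_tendsto_zero square_summable_tendsto_zero D_consensus)
    from tendsto_add[OF along[OF this] gap]
    have "(\<lambda>k. norm (D (r k) undefined - avg (r k)) + F * infeasibility (r k) + norm (avg (r k) - A)) \<longlonglongrightarrow> 0"
      by simp
    then have "(\<lambda>k. c (r k) - A) \<longlonglongrightarrow> 0"
    proof (rule Lim_null_comparison[rotated], intro always_eventually allI)
      fix k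
      show "norm (c (r k) - A) \<le> norm (D (r k) undefined - avg (r k)) + F * infeasibility (r k) + norm (avg (r k) - A)"
        using c(2)[of "r k"] norm_triangle_ineq[of "c (r k) - avg (r k)" "avg (r k) - A"]
          norm_triangle_ineq4[of "D (r k) undefined - avg (r k)" "D (r k) undefined - c (r k)"] by simp
    qed
    then have "(\<lambda>k. c (r k)) \<longlonglongrightarrow> A" by (rule LIM_zero_cancel)
    from closed_sequentially[OF \<D>(2) _ this] c(1) show ?thesis by simp
  qed
  show "(\<lambda>k. X (r k) i) \<longlonglongrightarrow> xh i A"
  proof -
    have "(\<lambda>k. norm (X (r k) i - xh i (avg (r k))) + L / (2 * \<mu>) * norm (avg (r k) - A)) \<longlonglongrightarrow> 0 + L / (2 * \<mu>) * 0"
      by (intro tendsto_add tendsto_mult tendsto_const gap along square_summable_tendsto_zero code_error)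
    then have "(\<lambda>k. norm (X (r k) i - xh i (avg (r k))) + L / (2 * \<mu>) * norm (avg (r k) - A)) \<longlonglongrightarrow> 0"
      by simp
    then have "(\<lambda>k. X (r k) i - xh i A) \<longlonglongrightarrow> 0"
    proof (rule Lim_null_comparison[rotated, where g = "\<lambda>k. norm (X (r k) i - xh i (avg (r k))) + L / (2 * \<mu>) * norm (avg (r k) - A)"])
      show "\<forall>\<^sub>F k in sequentially. norm (X (r k) i - xh i A)
          \<le> norm (X (r k) i - xh i (avg (r k))) + L / (2 * \<mu>) * norm (avg (r k) - A)"
      proof (intro always_eventually allI)
        fix k
        show "norm (X (r k) i - xh i A) \<le> norm (X (r k) i - xh i (avg (r k))) + L / (2 * \<mu>) * norm (avg (r k) - A)"
          using norm_triangle_ineq[of "X (r k) i - xh i (avg (r k))" "xh i (avg (r k)) - xh i A"]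
            xh_lipschitz[OF avg_le[of "r k"] A, of i] by simp
      qed
    qed
    then show ?thesis by (rule LIM_zero_cancel)
  qed
  show "0 \<le> H A \<bullet> (Z - A)" if Z: "Z \<in> \<D>"
  proof -
    obtain K where K: "\<And>A A'. norm A \<le> R \<Longrightarrow> norm A' \<le> R \<Longrightarrow> norm (H A - H A') \<le> K * norm (A - A')"
      using H_lipschitz by blast
    have "(\<lambda>k. K * norm (avg (r k) - A)) \<longlonglongrightarrow> 0"
      using tendsto_mult[OF tendsto_const[of K] gap] by simp
    then have "(\<lambda>k. H (avg (r k)) - H A) \<longlonglongrightarrow> 0"
      by (rule Lim_null_comparison[rotated]) (simp add: K avg_le A)
    then have "(\<lambda>k. H (avg (r k))) \<longlonglongrightarrow> H A" by (rule LIM_zero_cancel)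
    then have "(\<lambda>k. max 0 (- (H (avg (r k)) \<bullet> (Z - avg (r k))))) \<longlonglongrightarrow> max 0 (- (H A \<bullet> (Z - A)))"
      using lim by (intro tendsto_intros)
    with along[OF stationarity_gap_tendsto_zero[OF Z]] have "max 0 (- (H A \<bullet> (Z - A))) = 0"
      using LIMSEQ_unique by blast
    then show ?thesis by simp
  qed
qed

end

section \<open>Blocks of columns\<close>

lemma block_mult: "D ** block blk Y i = block blk (D ** Y) i"
  by (simp add: block_def matrix_matrix_mult_def vec_eq_iff)

lemma block_diff: "block blk A i - block blk A' i = block blk (A - A' :: real^'n^'m) i"
  by (simp add: block_def vec_eq_iff)

lemma sum_block_column:
  fixes blk :: "'n::finite \<Rightarrow> 'i::finite" and g :: "'n \<Rightarrow> real"
  shows "(\<Sum>i\<in>UNIV. \<Sum>c\<in>UNIV. if blk c = i then g c else 0) = (\<Sum>c\<in>UNIV. g c)"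
  by (subst sum.swap) simp

lemma sum_block_entry:
  fixes blk :: "'n::finite \<Rightarrow> 'i::finite" and g :: "'m::finite \<Rightarrow> 'n \<Rightarrow> real"
  shows "(\<Sum>i\<in>UNIV. \<Sum>r\<in>UNIV. \<Sum>c\<in>UNIV. if blk c = i then g r c else 0)
    = (\<Sum>r\<in>UNIV. \<Sum>c\<in>UNIV. g r c)"
  by (subst sum.swap) (simp add: sum_block_column)

lemma sum_block_inner:
  fixes blk :: "'n::finite \<Rightarrow> 'i::finite" and A A' :: "real^'n^'m"
  shows "(\<Sum>i\<in>UNIV. block blk A i \<bullet> block blk A' i) = A \<bullet> A'"
proof -
  have "block blk A i \<bullet> block blk A' i
      = (\<Sum>r\<in>UNIV. \<Sum>c\<in>UNIV. if blk c = i then A $ r $ c * A' $ r $ c else 0)" for i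
    by (auto simp: inner_vec_def block_def intro!: sum.cong)
  then show ?thesis
    by (simp add: sum_block_entry inner_vec_def)
qed

lemma sum_block_norm11:
  fixes blk :: "'n::finite \<Rightarrow> 'i::finite" and A :: "real^'n^'m"
  shows "(\<Sum>i\<in>UNIV. norm11 (block blk A i)) = norm11 A"
proof -
  have "norm11 (block blk A i) = (\<Sum>r\<in>UNIV. \<Sum>c\<in>UNIV. if blk c = i then \<bar>A $ r $ c\<bar> else 0)" for i
    by (auto simp: norm11_def block_def intro!: sum.cong)
  then show ?thesis
    by (simp add: sum_block_entry norm11_def)
qed

lemma sum_block_reg:
  fixes blk :: "'n::finite \<Rightarrow> 'i::finite" and A :: "real^'n^'m"
  shows "(\<Sum>i\<in>UNIV. reg lam \<mu> (block blk A i)) = reg lam \<mu> A"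
  by (simp add: reg_def sum.distrib sum_distrib_left[symmetric] sum_block_norm11
      power2_norm_eq_inner sum_block_inner)

lemma sum_block_mult_transpose:
  fixes blk :: "'n::finite \<Rightarrow> 'i::finite" and A :: "real^'n^'m" and Y :: "real^'n^'k"
  shows "(\<Sum>i\<in>UNIV. block blk A i ** transpose (block blk Y i)) = A ** transpose Y"
proof -
  have "(block blk A i ** transpose (block blk Y i)) $ r $ k
      = (\<Sum>c\<in>UNIV. if blk c = i then A $ r $ c * Y $ k $ c else 0)" for i r k
    by (auto simp: matrix_matrix_mult_def transpose_def block_def intro!: sum.cong)
  then have "(\<Sum>i\<in>UNIV. block blk A i ** transpose (block blk Y i)) $ r $ k = (A ** transpose Y) $ r $ k" for r k
    by (simp add: sum_block_column) (simp add: matrix_matrix_mult_def transpose_def)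
  then show ?thesis by (simp add: vec_eq_iff)
qed

lemma sum_block_grad_D:
  fixes blk :: "'n::finite \<Rightarrow> 'i::finite" and S :: "real^'n^'m"
  shows "(\<Sum>i\<in>UNIV. grad_D (block blk S i) D (block blk Y i)) = grad_D S D Y"
  by (simp add: grad_D_eq block_mult block_diff sum_block_mult_transpose)

lemma sum_block_grad_X:
  fixes blk :: "'n::finite \<Rightarrow> 'i::finite" and S :: "real^'n^'m"
  shows "(\<Sum>i\<in>UNIV. grad_X (block blk S i) D (block blk Y i) \<bullet> (block blk Z i - block blk Y i))
    = grad_X S D Y \<bullet> (Z - Y)"
  by (simp add: grad_X_eq block_mult block_diff sum_block_inner)

text \<open>
  Fit, regularizer and gradients decompose over disjoint sets of columns, so the two variational
  inequalities are the same.
\<close>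

lemma stationary_blockwise_iff_joint:
  "stationary_blockwise blk S lam \<mu> \<alpha> Ds Xs \<longleftrightarrow> stationary_joint S lam \<mu> \<alpha> Ds Xs"
  unfolding stationary_blockwise_def stationary_joint_def
  by (simp add: sum.distrib sum_subtractf sum_block_reg sum_block_grad_X
      inner_sum_left[symmetric] sum_block_grad_D)

lemma tendsto_block:
  assumes "(f \<longlongrightarrow> A) F"
  shows "((\<lambda>x. block blk (f x) i) \<longlongrightarrow> block blk A i) F"
proof (intro vec_tendstoI)
  fix r c
  have "((\<lambda>x. f x $ r $ c) \<longlongrightarrow> A $ r $ c) F"
    by (intro tendsto_vec_nth assms)
  then show "((\<lambda>x. block blk (f x) i $ r $ c) \<longlongrightarrow> block blk A i $ r $ c) F"
    by (simp add: block_def)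
qed

lemma norm_hcat_le: "norm (hcat blk Y) \<le> (\<Sum>i\<in>UNIV. norm (Y i :: real^'n^'m))"
  for blk :: "'n::finite \<Rightarrow> 'i::finite"
proof -
  have "hcat blk Y = (\<Sum>i\<in>UNIV. block blk (Y i) i)"
    by (simp add: hcat_def block_def vec_eq_iff)
  moreover have "norm (block blk (Y i) i) \<le> norm (Y i)" for i
    unfolding norm_matrix_eq_frobenius
    by (intro real_sqrt_le_mono sum_mono) (simp add: block_def)
  ultimately show ?thesis
    by (simp add: sum_norm_le)
qed

section \<open>Convergence of the algorithm\<close>

lemma connected_windows:
  assumes "strongly_connected_graph (\<Union>\<nu>\<in>{k * B..<(k + 1) * B}. E \<nu>)"
    and "A \<supseteq> {k * B..<(k + 1) * B}"
  shows "strongly_connected_graph (\<Union>\<nu>\<in>A. E \<nu>)"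
proof -
  have "(\<Union>\<nu>\<in>{k * B..<(k + 1) * B}. E \<nu>) \<subseteq> (\<Union>\<nu>\<in>A. E \<nu>)"
    using assms(2) by (rule UN_mono) simp
  then show ?thesis
    using assms(1) rtrancl_mono unfolding strongly_connected_graph_def by blast
qed

text \<open>
  A window of length \<open>2 B\<close> at an arbitrary position contains an aligned window of length \<open>B\<close>.
\<close>

lemma mixing_weights_shifted:
  assumes connected: "B_strongly_connected E" and weights: "admissible_weights E W"
  shows "\<exists>\<theta> B. mixing_weights (\<lambda>\<nu>. W (\<nu> + s)) (\<lambda>\<nu>. E (\<nu> + s)) \<theta> B"
proof -
  obtain B where B: "B > 0" "\<And>k. strongly_connected_graph (\<Union>\<nu>\<in>{k * B..<(k + 1) * B}. E \<nu>)"
    using connected by (auto simp: B_strongly_connected_def)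
  obtain \<theta> where \<theta>: "0 < \<theta>" "\<theta> < 1"
    and W: "\<And>\<nu> i j. j \<in> in_nbhd (E \<nu>) i \<Longrightarrow> \<theta> \<le> W \<nu> $ i $ j"
      "\<And>\<nu> i j. j \<notin> in_nbhd (E \<nu>) i \<Longrightarrow> W \<nu> $ i $ j = 0"
    using weights by (auto simp: admissible_weights_def)
  have rows: "(\<Sum>j\<in>UNIV. W \<nu> $ i $ j) = 1" for \<nu> i
  proof -
    have "(W \<nu> *v 1) $ i = 1"
      using weights by (simp add: admissible_weights_def)
    then show ?thesis by (simp add: matrix_vector_mult_def)
  qed
  have cols: "(\<Sum>i\<in>UNIV. W \<nu> $ i $ j) = 1" for \<nu> j
  proof -
    have "(1 v* W \<nu>) $ j = 1"
      using weights by (simp add: admissible_weights_def)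
    then show ?thesis by (simp add: vector_matrix_mult_def)
  qed
  have window: "strongly_connected_graph (\<Union>\<nu>\<in>{t..<t + 2 * B}. E (\<nu> + s))" for t
  proof -
    define k where "k = Suc ((t + s) div B)"
    have "t + s \<le> k * B"
      using B(1) dividend_less_div_times[of B "t + s"] by (simp add: k_def)
    moreover have "k * B \<le> t + s + B"
      by (simp add: k_def)
    ultimately have "strongly_connected_graph (\<Union>\<nu>\<in>{t + s..<t + s + 2 * B}. E \<nu>)"
      by (intro connected_windows[OF B(2)[of k]]) auto
    moreover have "{t + s..<t + s + 2 * B} = (\<lambda>\<nu>. \<nu> + s) ` {t..<t + 2 * B}"
      by (simp add: add_ac)
    ultimately show ?thesis
      by (simp only: image_image)
  qed
  have "mixing_weights (\<lambda>\<nu>. W (\<nu> + s)) (\<lambda>\<nu>. E (\<nu> + s)) \<theta> (2 * B)"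
  proof
    fix \<nu> i j
    show "0 \<le> W (\<nu> + s) $ i $ j"
      using W[where \<nu> = "\<nu> + s" and i = i and j = j] \<theta>(1) by (cases "j \<in> in_nbhd (E (\<nu> + s)) i") auto
  qed (use \<theta> W rows cols window in auto)
  then show ?thesis by blast
qed

lemma sum_in_nbhd:
  fixes y :: "'i::finite \<Rightarrow> 'a::real_vector"
  assumes "admissible_weights E W"
  shows "(\<Sum>j\<in>in_nbhd (E \<nu>) i. W \<nu> $ i $ j *\<^sub>R y j) = (\<Sum>j\<in>UNIV. W \<nu> $ i $ j *\<^sub>R y j)"
  by (rule sum.mono_neutral_left) (use assms in \<open>auto simp: admissible_weights_def\<close>)

lemma uniform_bounds:
  fixes \<tau> :: "nat \<Rightarrow> 'i::finite \<Rightarrow> real"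
  assumes "\<And>i. bounded_uniformly_positive (\<lambda>\<nu>. \<tau> \<nu> i)"
  shows "\<exists>lo hi. 0 < lo \<and> (\<forall>\<nu> i. lo \<le> \<tau> \<nu> i \<and> \<tau> \<nu> i \<le> hi)"
proof -
  have "\<exists>a b. 0 < a \<and> (\<forall>\<nu>. a \<le> \<tau> \<nu> i \<and> \<tau> \<nu> i \<le> b)" for i
  proof -
    obtain b where "\<And>\<nu>. \<bar>\<tau> \<nu> i\<bar> \<le> b"
      using assms[of i] by (auto simp: bounded_uniformly_positive_def bounded_iff)
    moreover obtain a where "0 < a" "\<And>\<nu>. a \<le> \<tau> \<nu> i"
      using assms[of i] by (auto simp: bounded_uniformly_positive_def)
    ultimately show ?thesis by (metis abs_le_D1)
  qed
  then obtain a b where ab: "\<And>i. 0 < a i" "\<And>\<nu> i. a i \<le> \<tau> \<nu> i" "\<And>\<nu> i. \<tau> \<nu> i \<le> b i"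
    by metis
  have "0 < Min (range a)" "\<And>i. Min (range a) \<le> a i" "\<And>i. b i \<le> Max (range b)"
    using ab(1) by auto
  then show ?thesis
    using ab(2,3) order_trans by meson
qed

lemma admissible_steps_shifted:
  assumes "admissible_steps \<gamma>"
  shows "0 \<le> \<gamma> (Suc \<nu>)" and "\<gamma> (Suc \<nu>) \<le> 1"
    and "\<not> summable (\<lambda>\<nu>. \<gamma> (Suc \<nu>))" and "square_summable (\<lambda>\<nu>. \<gamma> (Suc \<nu>))"
proof -
  show "0 \<le> \<gamma> (Suc \<nu>)" "\<gamma> (Suc \<nu>) \<le> 1" "square_summable (\<lambda>\<nu>. \<gamma> (Suc \<nu>))"
    using assms by (auto simp: admissible_steps_def square_summable_def)
  show "\<not> summable (\<lambda>\<nu>. \<gamma> (Suc \<nu>))"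
  proof
    assume "summable (\<lambda>\<nu>. \<gamma> (Suc \<nu>))"
    then have "(\<lambda>n. \<Sum>\<nu><n. \<gamma> (Suc \<nu>)) \<longlonglongrightarrow> (\<Sum>\<nu>. \<gamma> (Suc \<nu>))"
      by (rule summable_LIMSEQ)
    moreover have "(\<Sum>\<nu><n. \<gamma> (Suc \<nu>)) = (\<Sum>\<nu>=1..n. \<gamma> \<nu>)" for n
      using sum.atLeast1_atMost_eq[of \<gamma> n] by simp
    ultimately show False
      using assms not_tendsto_and_filterlim_at_infinity[of sequentially] filterlim_at_top_imp_at_infinity
      by (auto simp: admissible_steps_def)
  qed
qed

theorem theorem1:
  fixes blk :: "'n::finite \<Rightarrow> 'i::finite"
    and S :: "real^'n^'m::finite"
    and lam \<mu> \<alpha> \<epsilon> :: real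
    and E :: "nat \<Rightarrow> ('i \<times> 'i) set"
    and W :: "nat \<Rightarrow> real^'i^'i"
    and \<gamma> :: "nat \<Rightarrow> real"
    and \<tau>D \<tau>X :: "nat \<Rightarrow> 'i \<Rightarrow> real"
    and D Dt U \<Theta> Pt :: "nat \<Rightarrow> 'i \<Rightarrow> real^'k::finite^'m"
    and X :: "nat \<Rightarrow> 'i \<Rightarrow> real^'n^'k"
  assumes "surj blk"
    and "lam > 0" and "\<mu> > 0" and "\<alpha> > 0"
    and "\<And>\<nu>. \<gamma> \<nu> > 0"
    and "\<And>\<nu> i. \<tau>D \<nu> i > 0" and "\<And>\<nu> i. \<tau>X \<nu> i > 0"
    and "d2l_run blk S lam \<mu> \<alpha> E W \<gamma> \<tau>D \<tau>X D Dt U X \<Theta> Pt"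
    and "B_strongly_connected E"
    and "admissible_weights E W"
    and "admissible_steps \<gamma>"
    and "\<And>i. bounded_uniformly_positive (\<lambda>\<nu>. \<tau>D \<nu> i)"
    and "\<And>i. bounded_uniformly_positive (\<lambda>\<nu>. \<tau>X \<nu> i)"
    and "\<epsilon> > 0"
    and "\<And>\<nu> i. \<tau>X \<nu> i = max \<epsilon> ((sigma_max (U \<nu> i))\<^sup>2)"
  shows "bounded (range (\<lambda>\<nu>. (average (D \<nu>), hcat blk (X \<nu>)))) \<and>
         (\<forall>Ds Xs. limit_point (\<lambda>\<nu>. (average (D \<nu>), hcat blk (X \<nu>))) (Ds, Xs) \<longrightarrow>
            stationary_blockwise blk S lam \<mu> \<alpha> Ds Xs \<and> stationary_joint S lam \<mu> \<alpha> Ds Xs) \<and>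
         (\<forall>i. (\<lambda>\<nu>. norm (D \<nu> i - average (D \<nu>))) \<longlonglongrightarrow> 0)"
proof -
  note run = assms(8)[unfolded d2l_run_def]
  let ?C = "\<lambda>i. block_space blk i :: (real^'n^'k) set" and ?T = "block blk S"
  obtain \<theta> B where mixing: "mixing_weights (\<lambda>\<nu>. W (\<nu> + 1)) (\<lambda>\<nu>. E (\<nu> + 1)) \<theta> B"
    using mixing_weights_shifted[OF assms(9,10)] by blast
  obtain \<tau>min hD where \<tau>D: "0 < \<tau>min" "\<And>\<nu> i. \<tau>min \<le> \<tau>D \<nu> i" "\<And>\<nu> i. \<tau>D \<nu> i \<le> hD"
    using uniform_bounds[of \<tau>D, OF assms(12)] by blast
  obtain hX where \<tau>X: "\<And>\<nu> i. \<tau>X \<nu> i \<le> hX"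
    using uniform_bounds[of \<tau>X, OF assms(13)] by blast
  have D_step: "D (Suc \<nu>) i = (\<Sum>j\<in>UNIV. W \<nu> $ i $ j *\<^sub>R U \<nu> j)" for \<nu> i
    using run by (simp add: sum_in_nbhd[OF assms(10)])
  have \<Theta>_step: "\<Theta> (Suc \<nu>) i = (\<Sum>j\<in>UNIV. W \<nu> $ i $ j *\<^sub>R \<Theta> \<nu> j)
      + (grad_D (?T i) (D (Suc \<nu>) i) (X (Suc \<nu>) i) - grad_D (?T i) (D \<nu> i) (X \<nu> i))" for \<nu> i
    using run by (simp add: sum_in_nbhd[OF assms(10)] add_diff_eq)
  obtain \<theta>0 B0 where "mixing_weights W E \<theta>0 B0"
    using mixing_weights_shifted[OF assms(9,10), of 0] by auto
  then have "(\<Sum>i\<in>UNIV. \<Sum>j\<in>UNIV. W 0 $ i $ j *\<^sub>R \<Theta> 0 j) = (\<Sum>j\<in>UNIV. \<Theta> 0 j)"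
    by (rule mixing_weights.sum_mix)
  moreover have "\<Theta> 0 i = grad_D (?T i) (D 0 i) (X 0 i)" for i
    using run by blast
  ultimately have \<Theta>_start: "(\<Sum>i\<in>UNIV. \<Theta> 1 i) = (\<Sum>i\<in>UNIV. grad_D (?T i) (D 1 i) (X 1 i))"
    by (simp add: \<Theta>_step sum.distrib sum_subtractf)
  have Pt: "Pt (Suc \<nu>) i = of_nat CARD('i) *\<^sub>R \<Theta> (Suc \<nu>) i - grad_D (?T i) (D (Suc \<nu>) i) (X (Suc \<nu>) i)" for \<nu> i
    using run by blast
  \<comment> \<open>Time is shifted by one: the step size at time 0 may exceed 1, so that \<open>D 1 i\<close> may be infeasible.\<close>
  interpret mixing_weights "\<lambda>\<nu>. W (\<nu> + 1)" "\<lambda>\<nu>. E (\<nu> + 1)" \<theta> B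
    by (rule mixing)
  interpret d2l "\<lambda>\<nu>. W (\<nu> + 1)" "\<lambda>\<nu>. E (\<nu> + 1)" \<theta> B lam \<mu> ?C ?T "dict_set \<alpha>" "\<lambda>\<nu>. \<gamma> (Suc \<nu>)"
    "\<lambda>\<nu>. \<tau>D (Suc \<nu>)" "\<lambda>\<nu>. \<tau>X (Suc \<nu>)" \<tau>min "max hD hX" "\<lambda>\<nu>. D (Suc \<nu>)" "\<lambda>\<nu>. Dt (Suc \<nu>)"
    "\<lambda>\<nu>. U (Suc \<nu>)" "\<lambda>\<nu>. \<Theta> (Suc \<nu>)" "\<lambda>\<nu>. X (Suc \<nu>)"
  proof
    fix \<nu> i
    show "0 \<le> lam" "0 < \<mu>" using assms by simp_all
    show "subspace (?C i)" by (rule subspace_block_space)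
    show "convex (dict_set \<alpha> :: (real^'k^'m) set)" "closed (dict_set \<alpha> :: (real^'k^'m) set)"
        "bounded (dict_set \<alpha> :: (real^'k^'m) set)"
      by (rule convex_dict_set closed_dict_set bounded_dict_set)+
    show "0 \<le> \<gamma> (Suc \<nu>)" "\<gamma> (Suc \<nu>) \<le> 1"
        "\<not> summable (\<lambda>\<nu>. \<gamma> (Suc \<nu>))" "square_summable (\<lambda>\<nu>. \<gamma> (Suc \<nu>))"
      by (rule admissible_steps_shifted[OF assms(11)])+
    show "0 < \<tau>min" "\<tau>min \<le> \<tau>D (Suc \<nu>) i" "\<tau>D (Suc \<nu>) i \<le> max hD hX"
      using \<tau>D by (simp_all add: le_max_iff_disj)
    show "0 \<le> \<tau>X (Suc \<nu>) i" "\<tau>X (Suc \<nu>) i \<le> max hD hX"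
      using \<tau>X assms(7) by (simp_all add: le_max_iff_disj less_imp_le)
    show "is_arg_min
        (\<lambda>D'. fit (?T i) D' (X (Suc \<nu>) i) + \<tau>D (Suc \<nu>) i / 2 * (norm (D' - D (Suc \<nu>) i))\<^sup>2
          + (of_nat CARD('i) *\<^sub>R \<Theta> (Suc \<nu>) i - grad_D (?T i) (D (Suc \<nu>) i) (X (Suc \<nu>) i)) \<bullet> (D' - D (Suc \<nu>) i))
        (\<lambda>D'. D' \<in> dict_set \<alpha>) (Dt (Suc \<nu>) i)"
      unfolding Pt[symmetric] using run by blast
    show "U (Suc \<nu>) i = D (Suc \<nu>) i + \<gamma> (Suc \<nu>) *\<^sub>R (Dt (Suc \<nu>) i - D (Suc \<nu>) i)"
      using run by blast
    show "is_arg_min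
        (\<lambda>Y. fit (?T i) (U (Suc \<nu>) i) Y + \<tau>X (Suc \<nu>) i / 2 * (norm (Y - X (Suc \<nu>) i))\<^sup>2
          + lam * norm11 Y + \<mu> * (norm Y)\<^sup>2)
        (\<lambda>Y. Y \<in> ?C i) (X (Suc (Suc \<nu>)) i)"
      using run by blast
    show "D (Suc (Suc \<nu>)) i = (\<Sum>j\<in>UNIV. W (\<nu> + 1) $ i $ j *\<^sub>R U (Suc \<nu>) j)"
      by (simp add: D_step)
    show "\<Theta> (Suc (Suc \<nu>)) i = (\<Sum>j\<in>UNIV. W (\<nu> + 1) $ i $ j *\<^sub>R \<Theta> (Suc \<nu>) j)
      + (grad_D (?T i) (D (Suc (Suc \<nu>)) i) (X (Suc (Suc \<nu>)) i)
        - grad_D (?T i) (D (Suc \<nu>) i) (X (Suc \<nu>) i))"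
      by (simp add: \<Theta>_step)
    show "(\<Sum>i\<in>UNIV. \<Theta> (Suc 0) i) = (\<Sum>i\<in>UNIV. grad_D (?T i) (D (Suc 0) i) (X (Suc 0) i))"
      using \<Theta>_start by simp
  qed
  have X_in: "X \<nu> i \<in> ?C i" for \<nu> i
  proof (cases \<nu>)
    case 0
    then show ?thesis using run by (simp add: block_space_def)
  next
    case (Suc \<nu>')
    then show ?thesis using run by (auto simp: is_arg_min_def)
  qed
  let ?s = "\<lambda>\<nu>. (average (D \<nu>), hcat blk (X \<nu>))"
  have "bounded (range ?s)"
  proof -
    have "norm (?s (Suc \<nu>)) \<le> R + of_nat CARD('i) * R" for \<nu>
    proof -
      have "norm (?s (Suc \<nu>)) \<le> norm (average (D (Suc \<nu>))) + norm (hcat blk (X (Suc \<nu>)))"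
        by (rule norm_Pair_le)
      also have "norm (hcat blk (X (Suc \<nu>))) \<le> (\<Sum>i\<in>(UNIV::'i set). R)"
        by (rule order_trans[OF norm_hcat_le sum_mono]) (rule X_le)
      finally show ?thesis using avg_le[of \<nu>] by (simp add: avg_def)
    qed
    then have "bounded (range (\<lambda>\<nu>. ?s (Suc \<nu>)))"
      by (intro boundedI) auto
    moreover have "range ?s = insert (?s 0) (range (\<lambda>\<nu>. ?s (Suc \<nu>)))"
      by (rule UNIV_nat_eq[THEN arg_cong[where f = "image ?s"], simplified image_insert image_image])
    ultimately show ?thesis by simp
  qed
  moreover have "stationary_blockwise blk S lam \<mu> \<alpha> Ds Xs" if lp: "limit_point ?s (Ds, Xs)" for Ds Xs
  proof -
    obtain r where r: "strict_mono r" and lim: "(\<lambda>k. ?s (r k)) \<longlonglongrightarrow> (Ds, Xs)"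
      using lp unfolding limit_point_def o_def by blast
    \<comment> \<open>The subsequence in shifted time; its first term is dropped because \<open>r 0\<close> may be 0.\<close>
    define r' where "r' k = r (Suc k) - 1" for k
    have r_pos: "1 \<le> r (Suc k)" for k
      using strict_mono_imp_increasing[OF r, of "Suc k"] by simp
    have r'_eq: "Suc (r' k) = r (Suc k)" for k
      using r_pos[of k] by (simp add: r'_def)
    have r': "strict_mono r'"
    proof (rule strict_monoI)
      fix k l :: nat assume "k < l"
      then have "r (Suc k) < r (Suc l)" using r by (simp add: strict_mono_less)
      then show "r' k < r' l" using r'_eq[of k] r'_eq[of l] by linarith
    qed
    have lim': "(\<lambda>k. ?s (Suc (r' k))) \<longlonglongrightarrow> (Ds, Xs)"
      unfolding r'_eq using LIMSEQ_Suc[OF lim] .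
    have lim_D: "(\<lambda>k. avg (r' k)) \<longlonglongrightarrow> Ds"
      using tendsto_fst[OF lim'] by (simp add: avg_def)
    have code: "block blk Xs i = xh i Ds" for i
    proof (rule LIMSEQ_unique)
      show "(\<lambda>k. X (Suc (r' k)) i) \<longlonglongrightarrow> xh i Ds"
        by (rule limit_code[OF r' lim_D])
      show "(\<lambda>k. X (Suc (r' k)) i) \<longlonglongrightarrow> block blk Xs i"
        using tendsto_block[OF tendsto_snd[OF lim'], of blk i] by (simp add: block_hcat X_in)
    qed
    show ?thesis
      unfolding stationary_blockwise_def
    proof (intro conjI ballI allI)
      show "Ds \<in> dict_set \<alpha>"
        by (rule limit_feasible[OF r' lim_D])
      fix Z :: "real^'k^'m" and Y :: "real^'n^'k"
      assume Z: "Z \<in> dict_set \<alpha>"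
      have "0 \<le> (\<Sum>i\<in>UNIV. grad_D (?T i) Ds (block blk Xs i)) \<bullet> (Z - Ds)"
        using limit_stationary[OF r' lim_D Z] by (simp add: H_def code)
      moreover have "0 \<le> (\<Sum>i\<in>UNIV. grad_X (?T i) Ds (block blk Xs i) \<bullet> (block blk Y i - block blk Xs i)
          + reg lam \<mu> (block blk Y i) - reg lam \<mu> (block blk Xs i))"
        unfolding code by (intro sum_nonneg en.xhat_stationary block_in_block_space)
      ultimately show "0 \<le> (\<Sum>i\<in>UNIV. grad_D (?T i) Ds (block blk Xs i) \<bullet> (Z - Ds)
          + grad_X (?T i) Ds (block blk Xs i) \<bullet> (block blk Y i - block blk Xs i)
          + reg lam \<mu> (block blk Y i) - reg lam \<mu> (block blk Xs i))"
        by (simp add: sum.distrib sum_subtractf inner_sum_left)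
    qed
  qed
  moreover have "(\<lambda>\<nu>. norm (D \<nu> i - average (D \<nu>))) \<longlonglongrightarrow> 0" for i
    using square_summable_tendsto_zero[OF D_consensus[of i]] unfolding avg_def
    by (rule LIMSEQ_imp_Suc[where f = "\<lambda>\<nu>. norm (D \<nu> i - average (D \<nu>))"])
  ultimately show ?thesis
    by (simp add: stationary_blockwise_iff_joint)
qed

end
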